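(* Let $A$ be a pseudo-ASL over a field $R$ with a pseudo-ASL term order $\preceq$ and an algebra of leading terms $A_{lt}$. If $A_{lt}$ is a domain (equivalently, $A$ is a domain and $A_{lt}\cong A_{gen}$), then the S-closure algorithm correctly computes pseudo-ASL Gröbner bases in $A$: for every finite list $f_1,\dots,f_s\in A$ the algorithm terminates, and its output is a pseudo-ASL Gröbner basis of $\langle f_1,\dots,f_s\rangle$ with respect to $(\preceq,A_{lt})$.
   Context: All algebras are commutative, associative, unital; $R$ is a field; $\mathbb W=\{0,1,2,\dots\}$; for finite $H$, $\mathbb W^H$ is the monoid of monomials on $H$ (written multiplicatively), and an ideal of $\mathbb W^H$ is a subset closed under multiplication by $\mathbb W^H$. Pseudo-ASL $(A,H,\Sigma)$: an $R$-algebra $A$, a finite generating set $H$, an ideal $\Sigma\subseteq\mathbb W^H$ with $H\cap\Sigma=\emptyset$, such that the products $\prod_{h}h^{m(h)}$, $m\in\mathbb W^H\setminus\Sigma$ (the standard monomials), form an $R$-basis of $A$. Standard terms are $R$-multiples of standard monomials. $LM,LC,LT$ denote leading monomial, coefficient, term for a given total order on standard monomials; $LT(0)=0$. Pseudo-ASL term order: a total order $\preceq$ on standard monomials with $1\preceq m$ for all $m$, and $LM(fh)\prec LM(gk)$ whenever $f,g,h,k$ are standard monomials with $f\prec g$, $h\preceq k$, $fh\neq0\neq gk$. Algebra of leading terms for $(A,\preceq)$: a pseudo-ASL $A_{lt}$ with the same $(H,\Sigma)$ such that, with $\pi_{lt}:A\to A_{lt}$ the $R$-linear bijection that is the identity on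 standard monomials, $\pi_{lt}(m)\pi_{lt}(m')\in\{0,\pi_{lt}(LT(mm'))\}$ for all standard monomials $m,m'$. The generic one, $A_{gen}$, has $R$-basis the standard monomials and product $\pi(m)\pi(m')=\pi(LT(mm'))$ for all standard monomials; $A_{lt}\cong A_{gen}$ means isomorphic via the map that is the identity on standard monomials. Pseudo-ASL Gröbner basis of an ideal $I\subseteq A$: a subset $G\subseteq I$ with $\langle\pi_{lt}(LT(f)):f\in I\rangle=\langle\pi_{lt}(LT(g)):g\in G\rangle$ in $A_{lt}$. For standard terms, $t\mid_{lt}t'$ means $\pi_{lt}(t)$ divides $\pi_{lt}(t')$ in $A_{lt}$, and $t'/_{lt}\,t\in A_{lt}$ is then the unique standard term with $(t'/_{lt}t)\pi_{lt}(t)=\pi_{lt}(t')$. For nonzero $f,g\in A$, let $L$ be the set of standard monomials of $A_{lt}$ that are common multiples of $\pi_{lt}(LT(f)),\pi_{lt}(LT(g))$ and minimal under divisibility; the S-set is $S(f,g)=\{\pi_{lt}^{-1}(l/_{lt}LT(f))f-\pi_{lt}^{-1}(l/_{lt}LT(g))g : l\in L\}$ (empty if $f$ or $g$ is $0$). Standard monomials $m,m'$ are compatible if $\pi_{lt}(m)\pi_{lt}(m')\neq0$; $h\in A$ is compatible with $m'$ if every standard monomial occurring in $h$ is. $r$ is a remainder of $f$ relative to $\{g_1,\dots,g_k\}$ if $f=r+\sum h_ig_i$ where no standard term of $r$ is $\mid_{lt}$-divisible by any $LT(g_i)$, $LM(h_ig_i)\preceq LM(f)$ for all $i$ (with $h_ig_i\ne0$),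 and each $h_i$ is compatible with $LT(g_i)$. S-closure algorithm: start with $G=\{f_1,\dots,f_s\}$. Repeat: set $G_{prev}:=G$; for each $p,q\in G_{prev}$ and each $s\in S(p,q)$ compute a remainder of $s$ relative to $G_{prev}$ and add it to $G$ if it is nonzero; until $G=G_{prev}$. Output $G$. Computational conventions: field operations of $R$ are computable; one is given $H$, generators of $\Sigma$, algorithms for multiplying standard monomials in $A$ and in $A_{lt}$ and for deciding $\preceq$, and a finite generating set of $\ker(R[H]\to A_{lt})$ by polynomials with at most two terms. *)

theory Defs
  imports Complex_Main "HOL-Library.Poly_Mapping"
begin

text \<open>
  Throughout, the field is a type of class \<open>field\<close> and the algebras are types of class
  \<open>comm_ring_1\<close> together with a scalar multiplication.  The monoid of monomials on \<open>H\<close> is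
  written additively: a monomial is its exponent vector, and the monomial \<open>1\<close> is \<open>0\<close>.
\<close>

locale comm_algebra = vector_space scale
  for scale :: "'k::field \<Rightarrow> 'a::comm_ring_1 \<Rightarrow> 'a" +
  assumes scale_mult: "scale c x * y = scale c (x * y)"

definition ring_is_domain :: "'a::comm_ring_1 itself \<Rightarrow> bool" where
  "ring_is_domain _ \<longleftrightarrow> (\<forall>x y :: 'a. x * y = 0 \<longrightarrow> x = 0 \<or> y = 0)"

text \<open>A ring is a module over itself; the ideal generated by a set is its span.\<close>

abbreviation ideal_gen :: "'a::comm_ring_1 set \<Rightarrow> 'a set" where
  "ideal_gen S \<equiv> module.span (*) S"

type_synonym 'h monomial = "'h \<Rightarrow>\<^sub>0 nat"

definition monomials :: "'h set \<Rightarrow> 'h monomial set" where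
  "monomials H = {m. Poly_Mapping.keys m \<subseteq> H}"

definition monomial_ideal :: "'h set \<Rightarrow> 'h monomial set \<Rightarrow> bool" where
  "monomial_ideal H N \<longleftrightarrow> N \<subseteq> monomials H \<and> (\<forall>m\<in>N. \<forall>n\<in>monomials H. m + n \<in> N)"

text \<open>
  The generators are indexed by a label set \<open>vars\<close>, so that two algebras can share the same
  pair \<open>(H, \<Sigma>)\<close>; \<open>var\<close> sends a label to the element of the algebra, and \<open>nonstd\<close> is \<open>\<Sigma>\<close>.
\<close>

record ('k, 'a, 'h) pasl =
  smul :: "'k \<Rightarrow> 'a \<Rightarrow> 'a"
  vars :: "'h set"
  var :: "'h \<Rightarrow> 'a"
  nonstd :: "'h monomial set"

definition mon :: "('k::field, 'a::comm_ring_1, 'h) pasl \<Rightarrow> 'h monomial \<Rightarrow> 'a" where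
  "mon A m = (\<Prod>h\<in>vars A. var A h ^ Poly_Mapping.lookup m h)"

definition std :: "('k::field, 'a::comm_ring_1, 'h) pasl \<Rightarrow> 'h monomial set" where
  "std A = monomials (vars A) - nonstd A"

definition pseudo_asl :: "('k::field, 'a::comm_ring_1, 'h) pasl \<Rightarrow> bool" where
  "pseudo_asl A \<longleftrightarrow>
     comm_algebra (smul A) \<and>
     finite (vars A) \<and>
     module.span (smul A) (mon A ` monomials (vars A)) = UNIV \<and>
     monomial_ideal (vars A) (nonstd A) \<and>
     (\<forall>h\<in>vars A. Poly_Mapping.single h 1 \<notin> nonstd A) \<and>
     inj_on (mon A) (std A) \<and>
     \<not> module.dependent (smul A) (mon A ` std A) \<and>
     module.span (smul A) (mon A ` std A) = UNIV"

definition coeff :: "('k::field, 'a::comm_ring_1, 'h) pasl \<Rightarrow> 'a \<Rightarrow> 'h monomial \<Rightarrow> 'k" where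
  "coeff A f m = module.representation (smul A) (mon A ` std A) f (mon A m)"

definition supp :: "('k::field, 'a::comm_ring_1, 'h) pasl \<Rightarrow> 'a \<Rightarrow> 'h monomial set" where
  "supp A f = {m \<in> std A. coeff A f m \<noteq> 0}"

definition std_term :: "('k::field, 'a::comm_ring_1, 'h) pasl \<Rightarrow> 'a \<Rightarrow> bool" where
  "std_term A t \<longleftrightarrow> (\<exists>c. \<exists>m\<in>std A. t = smul A c (mon A m))"

text \<open>
  A total order on the standard monomials is a relation on their exponent vectors.
  \<open>LM\<close> and \<open>LC\<close> are meaningful only for nonzero arguments.
\<close>

definition LM ::
  "('k::field, 'a::comm_ring_1, 'h) pasl \<Rightarrow> 'h monomial rel \<Rightarrow> 'a \<Rightarrow> 'h monomial" where
  "LM A ord f = (THE m. m \<in> supp A f \<and> (\<forall>n\<in>supp A f. (n, m) \<in> ord))"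

definition LC :: "('k::field, 'a::comm_ring_1, 'h) pasl \<Rightarrow> 'h monomial rel \<Rightarrow> 'a \<Rightarrow> 'k" where
  "LC A ord f = coeff A f (LM A ord f)"

definition LT :: "('k::field, 'a::comm_ring_1, 'h) pasl \<Rightarrow> 'h monomial rel \<Rightarrow> 'a \<Rightarrow> 'a" where
  "LT A ord f = (if f = 0 then 0 else smul A (LC A ord f) (mon A (LM A ord f)))"

definition pasl_term_order ::
  "('k::field, 'a::comm_ring_1, 'h) pasl \<Rightarrow> 'h monomial rel \<Rightarrow> bool" where
  "pasl_term_order A ord \<longleftrightarrow>
     linear_order_on (std A) ord \<and>
     (\<forall>m\<in>std A. (0, m) \<in> ord) \<and>
     (\<forall>f\<in>std A. \<forall>g\<in>std A. \<forall>h\<in>std A. \<forall>k\<in>std A.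
        (f, g) \<in> ord \<and> f \<noteq> g \<and> (h, k) \<in> ord \<and>
        mon A f * mon A h \<noteq> 0 \<and> mon A g * mon A k \<noteq> 0 \<longrightarrow>
        (LM A ord (mon A f * mon A h), LM A ord (mon A g * mon A k)) \<in> ord \<and>
        LM A ord (mon A f * mon A h) \<noteq> LM A ord (mon A g * mon A k))"

text \<open>For \<open>B\<close> with the same \<open>(H, \<Sigma>)\<close> as \<open>A\<close> this is \<open>\<pi>\<close>, the linear map that is the identity on standard monomials.\<close>

definition to_lt ::
  "('k::field, 'a::comm_ring_1, 'h) pasl \<Rightarrow> ('k, 'b::comm_ring_1, 'h) pasl \<Rightarrow> 'a \<Rightarrow> 'b" where
  "to_lt A B f = (\<Sum>m\<in>supp A f. smul B (coeff A f m) (mon B m))"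

definition lt_algebra ::
  "('k::field, 'a::comm_ring_1, 'h) pasl \<Rightarrow> 'h monomial rel \<Rightarrow>
   ('k, 'b::comm_ring_1, 'h) pasl \<Rightarrow> bool" where
  "lt_algebra A ord B \<longleftrightarrow>
     pseudo_asl B \<and> vars B = vars A \<and> nonstd B = nonstd A \<and>
     (\<forall>m\<in>std A. \<forall>n\<in>std A.
        to_lt A B (mon A m) * to_lt A B (mon A n)
          \<in> {0, to_lt A B (LT A ord (mon A m * mon A n))})"

text \<open>
  The generic algebra of leading terms, realised on the vector space underlying \<open>A\<close>: its
  product is the bilinear extension of \<open>(m, n) \<mapsto> LT(mn)\<close> on standard monomials, and its unit
  is the monomial \<open>1\<close>.
\<close>

definition gen_mult ::
  "('k::field, 'a::comm_ring_1, 'h) pasl \<Rightarrow> 'h monomial rel \<Rightarrow> 'a \<Rightarrow> 'a \<Rightarrow> 'a" where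
  "gen_mult A ord f g =
     (\<Sum>m\<in>supp A f. \<Sum>n\<in>supp A g.
        smul A (coeff A f m * coeff A g n) (LT A ord (mon A m * mon A n)))"

definition lt_iso_gen ::
  "('k::field, 'a::comm_ring_1, 'h) pasl \<Rightarrow> 'h monomial rel \<Rightarrow>
   ('k, 'b::comm_ring_1, 'h) pasl \<Rightarrow> bool" where
  "lt_iso_gen A ord B \<longleftrightarrow>
     bij (to_lt A B) \<and> Vector_Spaces.linear (smul A) (smul B) (to_lt A B) \<and>
     to_lt A B (mon A 0) = 1 \<and>
     (\<forall>f g. to_lt A B (gen_mult A ord f g) = to_lt A B f * to_lt A B g)"

definition groebner_basis ::
  "('k::field, 'a::comm_ring_1, 'h) pasl \<Rightarrow> 'h monomial rel \<Rightarrow>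
   ('k, 'b::comm_ring_1, 'h) pasl \<Rightarrow> 'a set \<Rightarrow> 'a set \<Rightarrow> bool" where
  "groebner_basis A ord B I G \<longleftrightarrow>
     G \<subseteq> I \<and>
     ideal_gen ((\<lambda>f. to_lt A B (LT A ord f)) ` I) =
     ideal_gen ((\<lambda>g. to_lt A B (LT A ord g)) ` G)"

definition dvd_lt ::
  "('k::field, 'a::comm_ring_1, 'h) pasl \<Rightarrow> ('k, 'b::comm_ring_1, 'h) pasl \<Rightarrow>
   'a \<Rightarrow> 'a \<Rightarrow> bool" where
  "dvd_lt A B t t' \<longleftrightarrow> to_lt A B t dvd to_lt A B t'"

definition quot_lt ::
  "('k::field, 'a::comm_ring_1, 'h) pasl \<Rightarrow> ('k, 'b::comm_ring_1, 'h) pasl \<Rightarrow>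
   'a \<Rightarrow> 'a \<Rightarrow> 'b" where
  "quot_lt A B t' t = (THE u. std_term B u \<and> u * to_lt A B t = to_lt A B t')"

definition common_multiples ::
  "('k::field, 'a::comm_ring_1, 'h) pasl \<Rightarrow> 'h monomial rel \<Rightarrow>
   ('k, 'b::comm_ring_1, 'h) pasl \<Rightarrow> 'a \<Rightarrow> 'a \<Rightarrow> 'h monomial set" where
  "common_multiples A ord B f g =
     {m \<in> std B. to_lt A B (LT A ord f) dvd mon B m \<and> to_lt A B (LT A ord g) dvd mon B m}"

definition min_common_multiples ::
  "('k::field, 'a::comm_ring_1, 'h) pasl \<Rightarrow> 'h monomial rel \<Rightarrow>
   ('k, 'b::comm_ring_1, 'h) pasl \<Rightarrow> 'a \<Rightarrow> 'a \<Rightarrow> 'h monomial set" where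
  "min_common_multiples A ord B f g =
     {l \<in> common_multiples A ord B f g.
        \<forall>l'\<in>common_multiples A ord B f g. mon B l' dvd mon B l \<longrightarrow> l' = l}"

definition S_set ::
  "('k::field, 'a::comm_ring_1, 'h) pasl \<Rightarrow> 'h monomial rel \<Rightarrow>
   ('k, 'b::comm_ring_1, 'h) pasl \<Rightarrow> 'a \<Rightarrow> 'a \<Rightarrow> 'a set" where
  "S_set A ord B f g =
     (if f = 0 \<or> g = 0 then {}
      else (\<lambda>l. inv (to_lt A B) (quot_lt A B (mon A l) (LT A ord f)) * f
              - inv (to_lt A B) (quot_lt A B (mon A l) (LT A ord g)) * g)
           ` min_common_multiples A ord B f g)"

text \<open>
  The second argument is a standard term; for a nonzero term the scalar is immaterial.  Only
  \<open>h = 0\<close> is compatible with \<open>t = 0\<close>.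
\<close>

definition compatible ::
  "('k::field, 'a::comm_ring_1, 'h) pasl \<Rightarrow> ('k, 'b::comm_ring_1, 'h) pasl \<Rightarrow>
   'a \<Rightarrow> 'a \<Rightarrow> bool" where
  "compatible A B h t \<longleftrightarrow> (\<forall>m\<in>supp A h. to_lt A B (mon A m) * to_lt A B t \<noteq> 0)"

text \<open>
  \<open>LM(0)\<close> counts as smaller than every standard monomial, so a nonzero summand can occur only
  if \<open>f\<close> is nonzero.
\<close>

definition is_remainder ::
  "('k::field, 'a::comm_ring_1, 'h) pasl \<Rightarrow> 'h monomial rel \<Rightarrow>
   ('k, 'b::comm_ring_1, 'h) pasl \<Rightarrow> 'a set \<Rightarrow> 'a \<Rightarrow> 'a \<Rightarrow> bool" where
  "is_remainder A ord B G f r \<longleftrightarrow>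
     (\<exists>h. f = r + (\<Sum>g\<in>G. h g * g) \<and>
          (\<forall>m\<in>supp A r. \<forall>g\<in>G. \<not> dvd_lt A B (LT A ord g) (smul A (coeff A r m) (mon A m))) \<and>
          (\<forall>g\<in>G. h g * g \<noteq> 0 \<longrightarrow> f \<noteq> 0 \<and> (LM A ord (h g * g), LM A ord f) \<in> ord) \<and>
          (\<forall>g\<in>G. compatible A B (h g) (LT A ord g)))"

text \<open>
  Remainders are not unique, so the algorithm is nondeterministic.  One execution of the loop
  body leads from \<open>G\<close> to \<open>G'\<close> if \<open>G'\<close> arises from some choice \<open>\<rho> p q s\<close> of the remainders.
\<close>

definition S_pass ::
  "('k::field, 'a::comm_ring_1, 'h) pasl \<Rightarrow> 'h monomial rel \<Rightarrow>
   ('k, 'b::comm_ring_1, 'h) pasl \<Rightarrow> 'a set \<Rightarrow> 'a set \<Rightarrow> bool" where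
  "S_pass A ord B G G' \<longleftrightarrow>
     (\<exists>\<rho>. (\<forall>p\<in>G. \<forall>q\<in>G. \<forall>s\<in>S_set A ord B p q. is_remainder A ord B G s (\<rho> p q s)) \<and>
          G' = G \<union> {\<rho> p q s | p q s.
                      p \<in> G \<and> q \<in> G \<and> s \<in> S_set A ord B p q \<and> \<rho> p q s \<noteq> 0})"

definition S_continue ::
  "('k::field, 'a::comm_ring_1, 'h) pasl \<Rightarrow> 'h monomial rel \<Rightarrow>
   ('k, 'b::comm_ring_1, 'h) pasl \<Rightarrow> 'a set \<Rightarrow> 'a set \<Rightarrow> bool" where
  "S_continue A ord B G G' \<longleftrightarrow> S_pass A ord B G G' \<and> G' \<noteq> G"

definition S_output ::
  "('k::field, 'a::comm_ring_1, 'h) pasl \<Rightarrow> 'h monomial rel \<Rightarrow>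
   ('k, 'b::comm_ring_1, 'h) pasl \<Rightarrow> 'a set \<Rightarrow> 'a set \<Rightarrow> bool" where
  "S_output A ord B F G \<longleftrightarrow> (S_continue A ord B)\<^sup>*\<^sup>* F G \<and> S_pass A ord B G G"

text \<open>
  Termination for every choice of remainders.  Every loop body that is entered can be completed
  (it ranges over finitely many S-elements, each of which has a remainder), and the
  loop is left after finitely many rounds.
\<close>

definition S_terminates ::
  "('k::field, 'a::comm_ring_1, 'h) pasl \<Rightarrow> 'h monomial rel \<Rightarrow>
   ('k, 'b::comm_ring_1, 'h) pasl \<Rightarrow> 'a set \<Rightarrow> bool" where
  "S_terminates A ord B F \<longleftrightarrow>
     (\<forall>G. (S_continue A ord B)\<^sup>*\<^sup>* F G \<longrightarrow>
        finite G \<and>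
        (\<forall>p\<in>G. \<forall>q\<in>G. finite (S_set A ord B p q) \<and>
           (\<forall>s\<in>S_set A ord B p q. \<exists>r. is_remainder A ord B G s r))) \<and>
     \<not> (\<exists>Gs. Gs 0 = F \<and> (\<forall>n. S_continue A ord B (Gs n) (Gs (Suc n))))"

end

theory Submission
  imports Defs
begin

text \<open>
  Everything rests on one nondegeneracy condition: no two standard monomials annihilate each other
  in \<open>A\<close>, and in the algebra of leading terms \<open>B\<close> the product of two standard monomials is
  the leading term of their product in \<open>A\<close>.  Under it the standard monomials form a commutative
  monoid under \<open>m \<cdot> n = LM(mn)\<close>, and the term order is strictly monotone for this
  product.  Hence \<open>LM(fg) = LM(f) \<cdot> LM(g)\<close> with no cancellation at the top, which makes \<open>A\<close>
  a domain.  As \<open>B\<close> satisfies the same hypotheses with the same order and the same monoid, \<open>B\<close> is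
  a domain for the same reason.  Conversely, nonzero products of standard monomials in \<open>B\<close> can only be the
  leading terms, and an isomorphism with the generic algebra says exactly that; so \<open>B\<close> being a
  domain, and \<open>A\<close> being a domain with \<open>B\<close> generic, are both equivalent to the condition
  (\<open>leading_iff_domain\<close>, \<open>leading_iff_iso_gen\<close>).

  Under this condition Buchberger's theory works with divisibility in the monoid in
  place of divisibility of exponent vectors.  Since a standard monomial divides every standard
  monomial with a larger exponent vector, Dickson's lemma gives all the finiteness statements: the term
  order is a well-order (\<open>wf_less\<close>), S-sets are finite (\<open>finite_min_common_multiples\<close>), and the
  chain of rounds that add a new remainder cannot be infinite
  (\<open>no_infinite_run\<close>).  The division algorithm provides the remainders (\<open>remainder_exists\<close>).

  When the loop is left, all S-elements have remainder zero.  The ideal is spanned, as a vector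
  space, by the multiples \<open>m g\<close> of basis elements by standard monomials.  Two such
  multiples with the same leading monomial \<open>M\<close> have a linear combination that is, up to
  combinations of multiples with smaller leading monomials, a multiple of an S-element
  (\<open>buchberger_cancel\<close>), and hence itself a combination of smaller multiples.  A spanning set with this
  property attains every leading monomial of the space it spans (\<open>span_leading\<close>), which is
  Buchberger's criterion (\<open>buchberger\<close>).
\<close>

section \<open>Dickson's lemma\<close>

lemma nat_seq_mono_subseq:
  fixes a :: "nat \<Rightarrow> nat"
  obtains r :: "nat \<Rightarrow> nat" where "strict_mono r" "incseq (\<lambda>i. a (r i))"
proof -
  obtain r :: "nat \<Rightarrow> nat" where r: "strict_mono r" "monoseq (\<lambda>i. a (r i))"
    using seq_monosub[of a] by blast
  consider "incseq (\<lambda>i. a (r i))" | "decseq (\<lambda>i. a (r i))"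
    using r(2) by (auto simp: monoseq_iff)
  then show thesis
  proof cases
    case 1
    with r(1) show thesis by (rule that)
  next
    case 2
    \<comment> \<open>A decreasing sequence of naturals is constant from an index of its least value on.\<close>
    obtain N where N: "\<And>i. a (r N) \<le> a (r i)"
      using ex_has_least_nat[of "\<lambda>_. True" _ "\<lambda>i. a (r i)"] by auto
    have "a (r (N + i)) = a (r N)" for i
      using N[of "N + i"] decseqD[OF 2, of N "N + i"] by simp
    then have "incseq (\<lambda>i. a (r (N + i)))"
      by (simp add: incseq_def)
    moreover have "strict_mono (\<lambda>i. r (N + i))"
      using r(1) by (simp add: strict_mono_def)
    ultimately show thesis
      by (intro that)
  qed
qed

text \<open>Refining subsequences one coordinate at a time makes finitely many coordinates monotone.\<close>

lemma finite_family_mono_subseq: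
  fixes a :: "'v \<Rightarrow> nat \<Rightarrow> nat"
  assumes "finite V"
  shows "\<exists>r :: nat \<Rightarrow> nat. strict_mono r \<and> (\<forall>v\<in>V. incseq (\<lambda>i. a v (r i)))"
  using assms
proof (induction V rule: finite_induct)
  case empty
  show ?case by (intro exI[of _ id]) (simp add: strict_mono_def)
next
  case (insert v V)
  then obtain r :: "nat \<Rightarrow> nat" where r: "strict_mono r" "\<forall>v\<in>V. incseq (\<lambda>i. a v (r i))"
    by blast
  obtain s :: "nat \<Rightarrow> nat" where s: "strict_mono s" "incseq (\<lambda>i. a v (r (s i)))"
    by (rule nat_seq_mono_subseq[of "\<lambda>i. a v (r i)"])
  have "incseq (\<lambda>i. a w (r (s i)))" if "w \<in> V" for w
    using r(2) that s(1) by (auto simp: incseq_def strict_mono_less_eq)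
  moreover have "strict_mono (\<lambda>i. r (s i))"
    using r(1) s(1) by (simp add: strict_mono_def)
  ultimately show ?case
    using s(2) by (intro exI[of _ "\<lambda>i. r (s i)"]) auto
qed

text \<open>
  Stated for sequences because it is used to exclude infinite sequences; the complementary monomial
  \<open>n\<close> is the witness that \<open>m i\<close> divides \<open>m j\<close>.
\<close>

lemma dickson:
  fixes m :: "nat \<Rightarrow> 'h monomial"
  assumes "finite V" and keys: "\<And>i. Poly_Mapping.keys (m i) \<subseteq> V"
  obtains i j n where "i < j" "Poly_Mapping.keys n \<subseteq> V" "m j = m i + n"
proof -
  obtain r :: "nat \<Rightarrow> nat"
    where r: "strict_mono r" "\<forall>v\<in>V. incseq (\<lambda>i. Poly_Mapping.lookup (m (r i)) v)"
    using finite_family_mono_subseq[OF assms(1), of "\<lambda>v i. Poly_Mapping.lookup (m i) v"] by blast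
  let ?i = "r 0" and ?j = "r 1"
  have le: "Poly_Mapping.lookup (m ?i) v \<le> Poly_Mapping.lookup (m ?j) v" for v
  proof (cases "v \<in> V")
    case True
    then show ?thesis using r(2) by (simp add: incseq_def)
  next
    case False
    then have "Poly_Mapping.lookup (m ?i) v = 0"
      using keys[of ?i] by (auto simp: in_keys_iff)
    then show ?thesis by simp
  qed
  show thesis
  proof (rule that[of ?i ?j "m ?j - m ?i"])
    show "?i < ?j"
      using r(1) by (simp add: strict_mono_def)
    show "m ?j = m ?i + (m ?j - m ?i)"
      using le by (intro poly_mapping_eqI) (simp add: lookup_add lookup_minus)
    show "Poly_Mapping.keys (m ?j - m ?i) \<subseteq> V"
      using keys[of ?j] by (auto simp: in_keys_iff lookup_minus)
  qed
qed

section \<open>Coefficients with respect to the standard monomials\<close>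

lemma module_mult: "module ((*) :: 'a::comm_ring_1 \<Rightarrow> 'a \<Rightarrow> 'a)"
  by unfold_locales (simp_all add: algebra_simps)

locale pasl_algebra =
  fixes A :: "('k::field, 'a::comm_ring_1, 'h) pasl"
  assumes pseudo_asl: "pseudo_asl A"
begin

sublocale comm_algebra "smul A"
  using pseudo_asl by (simp add: pseudo_asl_def)

lemma finite_vars: "finite (vars A)"
  and ideal_nonstd: "monomial_ideal (vars A) (nonstd A)"
  and inj_mon: "inj_on (mon A) (std A)"
  and indep_std: "independent (mon A ` std A)"
  and span_std: "span (mon A ` std A) = UNIV"
  using pseudo_asl by (auto simp: pseudo_asl_def)

lemma mult_scale: "x * smul A c y = smul A c (x * y)"
  by (metis mult.commute scale_mult)

lemma keys_std: "m \<in> std A \<Longrightarrow> Poly_Mapping.keys m \<subseteq> vars A"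
  by (auto simp: std_def monomials_def)

lemma mon_0 [simp]: "mon A 0 = 1"
  by (simp add: mon_def)

lemma mon_add: "mon A (m + n) = mon A m * mon A n"
  by (simp add: mon_def lookup_add power_add prod.distrib)

text \<open>
  An ideal of monomials that contains \<open>1\<close> contains everything; then nothing would be standard and the
  algebra would be zero.
\<close>

lemma zero_std [simp]: "0 \<in> std A"
proof (rule ccontr)
  assume "0 \<notin> std A"
  then have "0 \<in> nonstd A"
    by (auto simp: std_def monomials_def)
  then have "std A = {}"
    using ideal_nonstd by (force simp: monomial_ideal_def std_def)
  then have "(1::'a) \<in> {0}"
    using span_std by auto
  then show False by simp
qed

lemma std_factor:
  assumes "m + n \<in> std A" "Poly_Mapping.keys m \<subseteq> vars A" "Poly_Mapping.keys n \<subseteq> vars A"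
  shows "n \<in> std A"
proof -
  have "n \<notin> nonstd A"
    using assms ideal_nonstd
    by (force simp: monomial_ideal_def std_def monomials_def add.commute)
  then show ?thesis
    using assms by (simp add: std_def monomials_def)
qed

lemma coeff_zero [simp]: "coeff A 0 m = 0"
  by (simp add: coeff_def representation_zero)

lemma coeff_add: "coeff A (f + g) m = coeff A f m + coeff A g m"
  by (simp add: coeff_def representation_add indep_std span_std)

lemma coeff_diff: "coeff A (f - g) m = coeff A f m - coeff A g m"
  by (simp add: coeff_def representation_diff indep_std span_std)

lemma coeff_scale: "coeff A (smul A c f) m = c * coeff A f m"
  by (simp add: coeff_def representation_scale indep_std span_std)

lemma coeff_sum: "coeff A (sum f I) m = (\<Sum>i\<in>I. coeff A (f i) m)"
  by (simp add: coeff_def representation_sum indep_std span_std)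

lemma coeff_mon:
  assumes "m \<in> std A" "n \<in> std A"
  shows "coeff A (mon A m) n = (if n = m then 1 else 0)"
  using assms inj_on_eq_iff[OF inj_mon]
  by (simp add: coeff_def representation_basis[OF indep_std])

lemma finite_supp: "finite (supp A f)"
proof (rule finite_imageD[of "mon A"])
  show "finite (mon A ` supp A f)"
    by (rule finite_subset[OF _ finite_representation[of "mon A ` std A" f]])
      (auto simp: supp_def coeff_def)
  show "inj_on (mon A) (supp A f)"
    using inj_mon by (rule inj_on_subset) (auto simp: supp_def)
qed

lemma supp_std: "m \<in> supp A f \<Longrightarrow> m \<in> std A"
  by (simp add: supp_def)

lemma expand: "f = (\<Sum>m\<in>supp A f. smul A (coeff A f m) (mon A m))"
proof -
  have "b \<in> mon A ` supp A f" if "representation (mon A ` std A) f b \<noteq> 0" for b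
    using representation_ne_zero[OF that] that by (auto simp: supp_def coeff_def)
  then have "(\<Sum>b | representation (mon A ` std A) f b \<noteq> 0.
      smul A (representation (mon A ` std A) f b) b) =
      (\<Sum>b\<in>mon A ` supp A f. smul A (representation (mon A ` std A) f b) b)"
    by (intro sum.mono_neutral_left) (auto simp: finite_supp)
  then have "f = (\<Sum>b\<in>mon A ` supp A f. smul A (representation (mon A ` std A) f b) b)"
    by (simp add: sum_nonzero_representation_eq indep_std span_std)
  also have "\<dots> = (\<Sum>m\<in>supp A f. smul A (coeff A f m) (mon A m))"
    by (subst sum.reindex) (auto simp: coeff_def intro!: inj_on_subset[OF inj_mon] dest: supp_std)
  finally show ?thesis .
qed

lemma coeff_eqI:
  assumes "\<And>m. m \<in> std A \<Longrightarrow> coeff A f m = coeff A g m"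
  shows "f = g"
proof -
  have "supp A (f - g) = {}"
    using assms by (simp add: supp_def coeff_diff)
  then have "f - g = 0"
    using expand[of "f - g"] by simp
  then show ?thesis by simp
qed

lemma supp_empty_iff [simp]: "supp A f = {} \<longleftrightarrow> f = 0"
proof
  assume "supp A f = {}"
  then show "f = 0"
    using expand[of f] by simp
qed (simp add: supp_def)

lemma supp_zero [simp]: "supp A 0 = {}"
  by simp

lemma supp_mon: "m \<in> std A \<Longrightarrow> supp A (mon A m) = {m}"
  by (auto simp: supp_def coeff_mon split: if_splits)

lemma supp_scale: "c \<noteq> 0 \<Longrightarrow> supp A (smul A c f) = supp A f"
  by (simp add: supp_def coeff_scale)

lemma mon_neq_0 [simp]: "m \<in> std A \<Longrightarrow> mon A m \<noteq> 0"
  using supp_mon[of m] by auto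

lemma supp_add_subset: "supp A (f + g) \<subseteq> supp A f \<union> supp A g"
  by (auto simp: supp_def coeff_add)

end

section \<open>Leading monomials\<close>

locale pasl_ordered = pasl_algebra A
  for A :: "('k::field, 'a::comm_ring_1, 'h) pasl" +
  fixes ord :: "'h monomial rel"
  assumes term_order: "pasl_term_order A ord"
begin

abbreviation le where "le m n \<equiv> (m, n) \<in> ord"
abbreviation less where "less m n \<equiv> (m, n) \<in> ord \<and> m \<noteq> n"
abbreviation lm where "lm f \<equiv> LM A ord f"
abbreviation lc where "lc f \<equiv> LC A ord f"
abbreviation lt where "lt f \<equiv> LT A ord f"

lemma lin: "linear_order_on (std A) ord"
  using term_order by (simp add: pasl_term_order_def)

lemma le_std: "le m n \<Longrightarrow> m \<in> std A \<and> n \<in> std A"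
  using lin by (auto simp: order_on_defs)

lemma le_refl: "m \<in> std A \<Longrightarrow> le m m"
  using lin by (simp add: order_on_defs refl_on_def)

lemma le_trans: "le l m \<Longrightarrow> le m n \<Longrightarrow> le l n"
  using lin by (simp add: order_on_defs) (meson transD)

lemma le_antisym: "le m n \<Longrightarrow> le n m \<Longrightarrow> m = n"
  using lin by (simp add: order_on_defs) (meson antisymD)

lemma le_less_trans: "le l m \<Longrightarrow> less m n \<Longrightarrow> less l n"
  by (metis le_antisym le_trans)

lemma not_le: "m \<in> std A \<Longrightarrow> n \<in> std A \<Longrightarrow> \<not> le m n \<longleftrightarrow> less n m"
  using lin le_antisym[of m n] le_refl[of m] by (auto simp: order_on_defs total_on_def)

lemma zero_le: "m \<in> std A \<Longrightarrow> le 0 m"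
  using term_order by (simp add: pasl_term_order_def)

lemma finite_has_greatest:
  assumes "finite S" "S \<noteq> {}" "S \<subseteq> std A"
  shows "\<exists>m\<in>S. \<forall>n\<in>S. le n m"
  using assms
proof (induction S rule: finite_ne_induct)
  case (singleton x)
  then show ?case by (simp add: le_refl)
next
  case (insert x S)
  then obtain m where m: "m \<in> S" "\<forall>n\<in>S. le n m" by auto
  show ?case
  proof (cases "le x m")
    case True
    then show ?thesis using m by auto
  next
    case False
    then have "le m x" using not_le[of x m] m insert.prems by auto
    then show ?thesis using m(2) le_trans le_refl insert.prems by blast
  qed
qed

lemma LM_eqI:
  assumes "m \<in> supp A f" "\<And>n. n \<in> supp A f \<Longrightarrow> le n m"
  shows "lm f = m"
  unfolding LM_def
  using assms by (intro the_equality) (auto intro: le_antisym)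

lemma LM_in_supp: "f \<noteq> 0 \<Longrightarrow> lm f \<in> supp A f"
  and supp_le_LM: "n \<in> supp A f \<Longrightarrow> le n (lm f)"
proof -
  have *: "lm f \<in> supp A f \<and> (\<forall>n\<in>supp A f. le n (lm f))" if "f \<noteq> 0"
  proof -
    have "\<exists>m\<in>supp A f. \<forall>n\<in>supp A f. le n m"
      using that by (intro finite_has_greatest) (auto simp: finite_supp supp_std)
    then obtain m where "m \<in> supp A f" "\<And>n. n \<in> supp A f \<Longrightarrow> le n m"
      by blast
    then show ?thesis using LM_eqI by metis
  qed
  from * show "f \<noteq> 0 \<Longrightarrow> lm f \<in> supp A f" by blast
  from * show "n \<in> supp A f \<Longrightarrow> le n (lm f)" by fastforce
qed

lemma LM_std: "f \<noteq> 0 \<Longrightarrow> lm f \<in> std A"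
  using LM_in_supp supp_std by blast

lemma LC_neq_0: "f \<noteq> 0 \<Longrightarrow> lc f \<noteq> 0"
  using LM_in_supp[of f] by (simp add: LC_def supp_def)

lemma LM_term: "c \<noteq> 0 \<Longrightarrow> m \<in> std A \<Longrightarrow> lm (smul A c (mon A m)) = m"
  by (rule LM_eqI) (simp_all add: supp_scale supp_mon le_refl)

lemma LM_mon: "m \<in> std A \<Longrightarrow> lm (mon A m) = m"
  using LM_term[of 1 m] by simp

text \<open>
  Compare \<open>1 \<cdot> m\<close> with \<open>n \<cdot> m\<close>, where \<open>1\<close> is smaller than \<open>n\<close>: both are standard monomials, so
  compatibility of the order with products applies even if other products degenerate.
\<close>

lemma less_add:
  assumes "m \<in> std A" "n \<in> std A" "m + n \<in> std A" "n \<noteq> 0"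
  shows "less m (m + n)"
proof -
  have *: "less (lm (mon A f * mon A h)) (lm (mon A g * mon A k))"
    if "f \<in> std A" "g \<in> std A" "h \<in> std A" "k \<in> std A" "less f g" "le h k"
      "mon A f * mon A h \<noteq> 0" "mon A g * mon A k \<noteq> 0" for f g h k
    using term_order that unfolding pasl_term_order_def by blast
  have "mon A n * mon A m = mon A (m + n)"
    by (simp add: mon_add mult.commute)
  then show ?thesis
    using *[of 0 n m m] assms zero_le[of n] by (simp add: LM_mon le_refl)
qed

text \<open>
  By Dickson's lemma an infinite descending chain would contain a monomial and, later, a proper
  multiple of it; but multiples are larger.
\<close>

lemma wf_less: "wf {(m, n). less m n}"
  unfolding wf_iff_no_infinite_down_chain
proof
  assume "\<exists>f. \<forall>i. (f (Suc i), f i) \<in> {(m, n). less m n}"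
  then obtain f where f: "\<And>i. less (f (Suc i)) (f i)"
    by blast
  have desc: "less (f j) (f i)" if "i < j" for i j
    using that
  proof (induction j rule: less_Suc_induct)
    case (1 i)
    then show ?case by (rule f)
  next
    case (2 i j k)
    show ?case by (rule le_less_trans[OF conjunct1[OF 2(4)] 2(3)])
  qed
  have std: "f i \<in> std A" for i
    using f[of i] le_std by blast
  obtain i j n where n: "i < j" "Poly_Mapping.keys n \<subseteq> vars A" "f j = f i + n"
    using dickson[OF finite_vars, of f] keys_std[OF std] by blast
  have "n \<in> std A"
    using std_factor[of "f i" n] n std[of j] keys_std[OF std] by simp
  moreover have "n \<noteq> 0"
    using desc[OF n(1)] n(3) by auto
  ultimately have "less (f i) (f j)"
    using less_add[of "f i" n] std[of i] std[of j] n(3) by simp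
  then show False
    using desc[OF n(1)] le_antisym by blast
qed

text \<open>
  Bounds on leading monomials are expressed by the linear subspaces \<open>below M\<close> and \<open>atmost M\<close>, which treat
  the zero element uniformly and turn estimates for sums into closure properties.
\<close>

definition below :: "'h monomial \<Rightarrow> 'a set" where
  "below M = {f. \<forall>m\<in>supp A f. less m M}"

definition atmost :: "'h monomial \<Rightarrow> 'a set" where
  "atmost M = {f. \<forall>m\<in>supp A f. le m M}"

lemma subspace_below: "subspace (below M)"
  unfolding subspace_def
proof (intro conjI ballI allI)
  show "0 \<in> below M"
    by (simp add: below_def)
  show "x + y \<in> below M" if "x \<in> below M" "y \<in> below M" for x y
    using that supp_add_subset[of x y] by (auto simp: below_def)
  show "smul A c x \<in> below M" if "x \<in> below M" for c x
    using that by (cases "c = 0") (simp_all add: below_def supp_scale)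
qed

lemma subspace_atmost: "subspace (atmost M)"
  unfolding subspace_def
proof (intro conjI ballI allI)
  show "0 \<in> atmost M"
    by (simp add: atmost_def)
  show "x + y \<in> atmost M" if "x \<in> atmost M" "y \<in> atmost M" for x y
    using that supp_add_subset[of x y] by (auto simp: atmost_def)
  show "smul A c x \<in> atmost M" if "x \<in> atmost M" for c x
    using that by (cases "c = 0") (simp_all add: atmost_def supp_scale)
qed

lemma below_iff: "f \<noteq> 0 \<Longrightarrow> f \<in> below M \<longleftrightarrow> less (lm f) M"
  unfolding below_def using LM_in_supp[of f] supp_le_LM[of _ f] le_less_trans by fast

lemma atmost_iff: "f \<noteq> 0 \<Longrightarrow> f \<in> atmost M \<longleftrightarrow> le (lm f) M"
  unfolding atmost_def using LM_in_supp[of f] supp_le_LM[of _ f] le_trans by fast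

lemma atmost_LM: "f \<in> atmost (lm f)"
  by (simp add: atmost_def supp_le_LM)

lemma below_coeff: "f \<in> below M \<Longrightarrow> M \<in> std A \<Longrightarrow> coeff A f M = 0"
  by (auto simp: below_def supp_def)

lemma atmost_coeff: "f \<in> atmost M \<Longrightarrow> M \<in> std A \<Longrightarrow> f \<in> below M \<longleftrightarrow> coeff A f M = 0"
  by (auto simp: atmost_def below_def supp_def)

lemma below_atmost: "f \<in> below M \<Longrightarrow> f \<in> atmost M"
  by (simp add: atmost_def below_def)

lemma atmost_mono: "f \<in> atmost M \<Longrightarrow> le M N \<Longrightarrow> f \<in> atmost N"
  by (auto simp: atmost_def intro: le_trans)

lemma minus_LT_below:
  assumes "f \<noteq> 0"
  shows "f - lt f \<in> below (lm f)"
proof -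
  have "less m (lm f)" if "m \<in> supp A (f - lt f)" for m
    using that assms LM_std[OF assms] supp_le_LM[of m f]
    by (auto simp: supp_def coeff_diff coeff_scale coeff_mon LT_def LC_def split: if_splits)
  then show ?thesis by (simp add: below_def)
qed

text \<open>The leading monomial and coefficient are recognised by exhibiting a tail.\<close>

lemma LM_eqI_diff:
  assumes "c \<noteq> 0" "M \<in> std A" "f - smul A c (mon A M) \<in> below M"
  shows "f \<noteq> 0" "lm f = M" "lc f = c"
proof -
  have c: "coeff A f M = c"
    using below_coeff[OF assms(3,2)] assms(2) by (simp add: coeff_diff coeff_scale coeff_mon)
  then show "f \<noteq> 0"
    using assms(1) by auto
  have "smul A c (mon A M) \<in> atmost M"
    using assms(1,2) by (simp add: atmost_def supp_scale supp_mon le_refl)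
  then have "(f - smul A c (mon A M)) + smul A c (mon A M) \<in> atmost M"
    using below_atmost[OF assms(3)] by (rule subspace_add[OF subspace_atmost, rotated])
  then have "f \<in> atmost M"
    by simp
  then show "lm f = M"
    using c assms(1,2) by (intro LM_eqI) (auto simp: atmost_def supp_def)
  then show "lc f = c"
    using c by (simp add: LC_def)
qed

lemma LT_zero [simp]: "lt 0 = 0"
  by (simp add: LT_def)

lemma LT_scale_mon [simp]: "m \<in> std A \<Longrightarrow> lt (smul A c (mon A m)) = smul A c (mon A m)"
  by (cases "c = 0") (simp_all add: LT_def LM_term LC_def coeff_scale coeff_mon)

lemma LT_mon [simp]: "m \<in> std A \<Longrightarrow> lt (mon A m) = mon A m"
  using LT_scale_mon[of m 1] by simp

lemma atmost_not_below_LM: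
  assumes "f \<in> atmost M" "f \<notin> below M" "M \<in> std A"
  shows "f \<noteq> 0 \<and> lm f = M"
proof -
  have M: "coeff A f M \<noteq> 0"
    using assms atmost_coeff by blast
  then have "lm f = M"
    using assms(1,3) by (intro LM_eqI) (auto simp: atmost_def supp_def)
  with M show ?thesis by auto
qed

text \<open>
  This is the linear algebra behind Buchberger's criterion.  Write \<open>f\<close> as a combination of elements
  of \<open>X\<close> with leading monomials at most \<open>M\<close>.  By the cancellation property the elements with leading
  monomial exactly \<open>M\<close> can all be traded for a single one, \<open>y\<close>.  If the coefficient of \<open>y\<close> is nonzero, it
  alone contributes \<open>M\<close>, so \<open>LM(f) = M\<close>.  Otherwise \<open>f\<close> is a combination of elements with smaller leading
  monomials; finitely many of these occur, so they are bounded by some \<open>N < M\<close>, and well-founded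
  induction on the bound applies.
\<close>

lemma span_leading:
  assumes nz: "\<And>x. x \<in> X \<Longrightarrow> x \<noteq> 0"
    and crit: "\<And>x y. x \<in> X \<Longrightarrow> y \<in> X \<Longrightarrow> lm x = lm y \<Longrightarrow>
      \<exists>c c'. c \<noteq> 0 \<and> smul A c x - smul A c' y \<in> span {z \<in> X. less (lm z) (lm x)}"
    and f: "f \<in> span X" "f \<noteq> 0"
  shows "\<exists>x\<in>X. lm f = lm x"
proof -
  \<comment> \<open>A combination involves finitely many elements, so one of their leading monomials bounds them all.\<close>
  have bound: "\<exists>M\<in>lm ` Y. f \<in> span {x \<in> X. le (lm x) M}"
    if Y: "Y \<subseteq> X" and f: "f \<in> span Y" "f \<noteq> 0" for f Y
  proof -
    obtain t r where t: "finite t" "t \<subseteq> Y" "f = (\<Sum>a\<in>t. smul A (r a) a)"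
      using f(1) unfolding span_explicit by blast
    have ne: "lm ` t \<noteq> {}"
      using f(2) t(3) by auto
    have "lm ` t \<subseteq> std A"
      using t(2) Y by (auto intro!: LM_std nz)
    from finite_has_greatest[OF finite_imageI[OF t(1)] ne this]
    obtain M where M: "M \<in> lm ` t" "\<forall>n\<in>lm ` t. le n M" by blast
    have "f \<in> span {x \<in> X. le (lm x) M}"
      unfolding t(3) using t(2) Y M(2) by (intro span_sum span_scale span_base) auto
    then show ?thesis using M(1) t(2) by blast
  qed
  have main: "f \<in> span {x \<in> X. le (lm x) M} \<Longrightarrow> f \<noteq> 0 \<Longrightarrow> \<exists>x\<in>X. lm f = lm x" for f M
  proof (induction M arbitrary: f rule: wf_induct_rule[OF wf_less])
    case (1 M f)
    let ?L = "{x \<in> X. less (lm x) M}"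
    have descend: ?case if L: "f \<in> span ?L"
    proof -
      obtain N where N: "N \<in> lm ` ?L" "f \<in> span {x \<in> X. le (lm x) N}"
        using bound[OF _ L 1(3)] by blast
      have "(N, M) \<in> {(m, n). less m n}"
        using N(1) by auto
      then show ?thesis
        using N(2) 1(3) by (rule 1(1))
    qed
    show ?case
    proof (cases "\<exists>y\<in>X. lm y = M")
      case False
      then have "{x \<in> X. le (lm x) M} = ?L" by auto
      then show ?thesis using descend 1(2) by simp
    next
      case True
      then obtain y where y: "y \<in> X" "lm y = M" by blast
      have M: "M \<in> std A"
        using y LM_std nz by blast
      have "x \<in> span (insert y ?L)" if x: "x \<in> X" "le (lm x) M" for x
      proof (cases "lm x = M")
        case True
        obtain c c' where c: "c \<noteq> 0" "smul A c x - smul A c' y \<in> span ?L"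
          using crit[OF x(1) y(1)] True y(2) by auto
        have "smul A (inverse c) (smul A c x - smul A c' y) \<in> span ?L"
          by (rule span_scale[OF c(2)])
        then show ?thesis
          using c(1) unfolding span_breakdown_eq
          by (intro exI[of _ "inverse c * c'"]) (simp add: scale_right_diff_distrib)
      qed (use x in \<open>auto intro: span_base\<close>)
      then have "span {x \<in> X. le (lm x) M} \<subseteq> span (insert y ?L)"
        by (intro span_minimal subspace_span) auto
      then obtain k where k: "f - smul A k y \<in> span ?L"
        using 1(2) span_breakdown_eq by blast
      show ?thesis
      proof (cases "k = 0")
        case True
        then show ?thesis using descend k by simp
      next
        case False
        have "span ?L \<subseteq> below M"
          using below_iff nz by (intro span_minimal subspace_below) auto
        then have v: "f - smul A k y \<in> below M"
          using k by blast
        have y': "y \<in> atmost M" "coeff A y M \<noteq> 0"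
          using y nz[of y] atmost_LM[of y] LC_neq_0[of y] by (auto simp: LC_def)
        have "(f - smul A k y) + smul A k y \<in> atmost M"
          by (rule subspace_add[OF subspace_atmost below_atmost[OF v]
                subspace_scale[OF subspace_atmost y'(1)]])
        then have "f \<in> atmost M"
          by simp
        moreover have "coeff A f M \<noteq> 0"
          using below_coeff[OF v M] y'(2) False by (simp add: coeff_diff coeff_scale)
        then have "f \<notin> below M"
          using below_coeff[of f M] M by blast
        ultimately have "lm f = lm y"
          using atmost_not_below_LM[OF _ _ M] y(2) by simp
        then show ?thesis using y(1) by blast
      qed
    qed
  qed
  show ?thesis
    using bound[OF subset_refl f] main[OF _ f(2)] by blast
qed

end

section \<open>Algebras in which standard monomials do not annihilate each other\<close>

locale pasl_nonzero = pasl_ordered A ord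
  for A :: "('k::field, 'a::comm_ring_1, 'h) pasl" and ord :: "'h monomial rel" +
  assumes mon_mult_neq_0: "\<And>m n. m \<in> std A \<Longrightarrow> n \<in> std A \<Longrightarrow> mon A m * mon A n \<noteq> 0"
begin

text \<open>
  The product of the monoid of standard monomials.  It agrees with the sum of exponent vectors when
  that sum is standard, and replaces it otherwise.
\<close>

definition mprod :: "'h monomial \<Rightarrow> 'h monomial \<Rightarrow> 'h monomial" where
  "mprod m n = lm (mon A m * mon A n)"

lemma mprod_commute: "mprod m n = mprod n m"
  by (simp add: mprod_def mult.commute)

lemma mprod_std: "m \<in> std A \<Longrightarrow> n \<in> std A \<Longrightarrow> mprod m n \<in> std A"
  unfolding mprod_def by (intro LM_std mon_mult_neq_0)

lemma mprod_zero [simp]: "m \<in> std A \<Longrightarrow> mprod 0 m = m"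
  by (simp add: mprod_def LM_mon)

lemma mprod_less_le: "less f g \<Longrightarrow> le h k \<Longrightarrow> less (mprod f h) (mprod g k)"
  using term_order mon_mult_neq_0[of f h] mon_mult_neq_0[of g k] le_std[of f g] le_std[of h k]
  unfolding pasl_term_order_def mprod_def by blast

lemma mprod_le_less: "le f g \<Longrightarrow> less h k \<Longrightarrow> less (mprod f h) (mprod g k)"
  using mprod_less_le[of h k f g] by (simp add: mprod_commute)

lemma mprod_le_le: "le f g \<Longrightarrow> le h k \<Longrightarrow> le (mprod f h) (mprod g k)"
  using mprod_less_le[of f g h k] mprod_le_less[of f g h k] le_std[of f g] le_std[of h k]
    le_refl[OF mprod_std, of f h] by (cases "f = g"; cases "h = k") simp_all

lemma mprod_cancel:
  assumes "m \<in> std A" "m' \<in> std A" "n \<in> std A" "mprod m n = mprod m' n"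
  shows "m = m'"
  using assms mprod_less_le[of m m' n n] mprod_less_le[of m' m n n] le_refl[of n] not_le[of m m']
  by auto

lemma le_mprod: "m \<in> std A \<Longrightarrow> n \<in> std A \<Longrightarrow> le n (mprod m n)"
  using mprod_le_le[of 0 m n n] by (simp add: zero_le le_refl)

lemma mult_in_subspace:
  assumes "subspace W"
    and "\<And>m n. m \<in> supp A f \<Longrightarrow> n \<in> supp A g \<Longrightarrow> mon A m * mon A n \<in> W"
  shows "f * g \<in> W"
proof -
  have "f * g = (\<Sum>m\<in>supp A f. smul A (coeff A f m) (mon A m)) *
      (\<Sum>n\<in>supp A g. smul A (coeff A g n) (mon A n))"
    using expand[of f] expand[of g] by simp
  also have "\<dots> = (\<Sum>m\<in>supp A f. \<Sum>n\<in>supp A g.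
      smul A (coeff A g n) (smul A (coeff A f m) (mon A m * mon A n)))"
    by (simp add: sum_product scale_mult mult_scale)
  also have "\<dots> \<in> W"
    using assms(2) by (intro subspace_sum subspace_scale assms(1))
  finally show ?thesis .
qed

lemma mult_below_atmost:
  assumes "f \<in> below M" "g \<in> atmost N"
  shows "f * g \<in> below (mprod M N)"
proof (rule mult_in_subspace[OF subspace_below])
  fix m n
  assume mn: "m \<in> supp A f" "n \<in> supp A g"
  then have "less (mprod m n) (mprod M N)"
    using assms by (intro mprod_less_le) (auto simp: below_def atmost_def)
  then show "mon A m * mon A n \<in> below (mprod M N)"
    using mon_mult_neq_0[OF supp_std[OF mn(1)] supp_std[OF mn(2)]] by (simp add: mprod_def below_iff)
qed

text \<open>
  Strict monotonicity of \<open>mprod\<close> puts every contribution to a product strictly below that of the two leading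
  terms.  The leading coefficient of the product of the leading monomials enters because this product in
  \<open>A\<close> need not be monic.
\<close>

lemma mult_leading:
  assumes "f \<noteq> 0" "g \<noteq> 0"
  defines "c \<equiv> lc f * lc g * lc (mon A (lm f) * mon A (lm g))"
  shows "f * g \<noteq> 0" "lm (f * g) = mprod (lm f) (lm g)" "lc (f * g) = c"
proof -
  let ?m = "lm f" and ?n = "lm g"
  let ?p = "mon A ?m * mon A ?n"
  let ?M = "mprod ?m ?n"
  have std: "?m \<in> std A" "?n \<in> std A"
    using assms LM_std by auto
  then have p: "?p \<noteq> 0"
    by (rule mon_mult_neq_0)
  have c: "c \<noteq> 0"
    using assms(1,2) p LC_neq_0 by (simp add: c_def)
  have g_atmost: "g \<in> atmost ?n" and f_tail: "f - lt f \<in> below ?m" and g_tail: "g - lt g \<in> below ?n"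
    and lt_atmost: "lt f \<in> atmost ?m"
    using assms(1,2) std minus_LT_below atmost_LM LC_neq_0[of f]
    by (auto simp: LT_def atmost_def supp_scale supp_mon le_refl supp_le_LM)
  have "?p - lt ?p \<in> below ?M"
    using minus_LT_below[OF p] by (simp add: mprod_def)
  then have tail: "smul A (lc f * lc g) (?p - lt ?p) \<in> below ?M"
    by (rule subspace_scale[OF subspace_below])
  have lt_prod: "lt f * lt g = smul A (lc f * lc g) ?p"
    using assms(1,2) by (simp add: LT_def scale_mult mult_scale mult.commute)
  have lt_p: "smul A (lc f * lc g) (lt ?p) = smul A c (mon A ?M)"
    using p by (simp add: LT_def c_def mprod_def)
  have "f * g - smul A c (mon A ?M) =
      (f - lt f) * g + (g - lt g) * lt f + smul A (lc f * lc g) (?p - lt ?p)"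
    by (simp add: scale_right_diff_distrib lt_p flip: lt_prod) (simp add: algebra_simps)
  also have "\<dots> \<in> below ?M"
    using mult_below_atmost[OF f_tail g_atmost] mult_below_atmost[OF g_tail lt_atmost] tail
    by (intro subspace_add[OF subspace_below]) (simp_all add: mprod_commute)
  finally have diff: "f * g - smul A c (mon A ?M) \<in> below ?M" .
  note res = LM_eqI_diff[OF c mprod_std[OF std] diff]
  from res(1) show "f * g \<noteq> 0" .
  from res(2) show "lm (f * g) = ?M" .
  from res(3) show "lc (f * g) = c" .
qed

lemma domain: "ring_is_domain TYPE('a)"
  using mult_leading(1) by (auto simp: ring_is_domain_def)

lemma LM_mult: "f \<noteq> 0 \<Longrightarrow> g \<noteq> 0 \<Longrightarrow> lm (f * g) = mprod (lm f) (lm g)"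
  by (rule mult_leading)

lemma mult_neq_0: "(f :: 'a) \<noteq> 0 \<Longrightarrow> g \<noteq> 0 \<Longrightarrow> f * g \<noteq> 0"
  by (rule mult_leading(1))

text \<open>Associativity is inherited from the algebra: both sides are the leading monomial of \<open>lmn\<close>.\<close>

lemma mprod_assoc:
  assumes "l \<in> std A" "m \<in> std A" "n \<in> std A"
  shows "mprod (mprod l m) n = mprod l (mprod m n)"
proof -
  have "mprod (mprod l m) n = lm (mon A l * mon A m * mon A n)"
    using assms by (simp add: LM_mult mon_mult_neq_0 LM_mon)
  also have "\<dots> = lm (mon A l * (mon A m * mon A n))"
    by (simp add: mult.assoc)
  also have "\<dots> = mprod l (mprod m n)"
    using assms by (simp add: LM_mult mon_mult_neq_0 LM_mon)
  finally show ?thesis .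
qed

end

section \<open>The algebra of leading terms\<close>

text \<open>
  The linear comparison of \<open>A\<close> with \<open>B\<close> is kept apart from the condition on products, since it
  serves to decide whether that condition holds.
\<close>

locale pasl_pair = A: pasl_ordered A ord + B: pasl_algebra B
  for A :: "('k::field, 'a::comm_ring_1, 'h) pasl" and ord :: "'h monomial rel"
    and B :: "('k, 'b::comm_ring_1, 'h) pasl" +
  assumes vars_eq: "vars B = vars A" and nonstd_eq: "nonstd B = nonstd A"
begin

lemma std_eq: "std B = std A"
  by (simp add: std_def vars_eq nonstd_eq)

abbreviation \<pi> where "\<pi> \<equiv> to_lt A B"

lemma coeff_to_lt:
  assumes "m \<in> std A"
  shows "coeff B (\<pi> f) m = coeff A f m"
proof -
  have "coeff B (\<pi> f) m = (\<Sum>n\<in>supp A f. coeff A f n * coeff B (mon B n) m)"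
    by (simp add: to_lt_def B.coeff_sum B.coeff_scale)
  also have "\<dots> = (\<Sum>n\<in>supp A f. if m = n then coeff A f n else 0)"
    using assms by (intro sum.cong) (auto simp: B.coeff_mon std_eq A.supp_std)
  also have "\<dots> = coeff A f m"
    using assms by (simp add: A.finite_supp) (simp add: supp_def)
  finally show ?thesis .
qed

lemma to_lt_eqI: "(\<And>m. m \<in> std A \<Longrightarrow> coeff A f m = coeff B g m) \<Longrightarrow> \<pi> f = g"
  by (rule B.coeff_eqI) (simp add: std_eq coeff_to_lt)

lemma to_lt_add: "\<pi> (f + g) = \<pi> f + \<pi> g"
  by (rule to_lt_eqI) (simp add: A.coeff_add B.coeff_add coeff_to_lt)

lemma to_lt_scale: "\<pi> (smul A c f) = smul B c (\<pi> f)"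
  by (rule to_lt_eqI) (simp add: A.coeff_scale B.coeff_scale coeff_to_lt)

lemma to_lt_sum: "\<pi> (sum f I) = (\<Sum>i\<in>I. \<pi> (f i))"
  by (rule to_lt_eqI) (simp add: A.coeff_sum B.coeff_sum coeff_to_lt)

lemma to_lt_mon: "m \<in> std A \<Longrightarrow> \<pi> (mon A m) = mon B m"
  by (rule to_lt_eqI) (simp add: A.coeff_mon B.coeff_mon std_eq)

lemma bij_to_lt: "bij \<pi>"
proof (rule bijI)
  show "inj \<pi>"
    by (rule injI) (metis A.coeff_eqI coeff_to_lt)
  have "g = \<pi> (\<Sum>m\<in>supp B g. smul A (coeff B g m) (mon A m))" for g
    using B.expand[of g] by (simp add: to_lt_sum to_lt_scale to_lt_mon B.supp_std flip: std_eq)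
  then show "surj \<pi>"
    by (rule surjI[OF sym])
qed

lemma to_lt_inject [simp]: "\<pi> f = \<pi> g \<longleftrightarrow> f = g"
  using bij_to_lt by (simp add: bij_def inj_eq)

lemma to_lt_zero [simp]: "\<pi> 0 = 0"
  by (simp add: to_lt_def)

lemma to_lt_eq_0_iff [simp]: "\<pi> f = 0 \<longleftrightarrow> f = 0"
  using to_lt_inject[of f 0] by simp

lemma linear_to_lt: "Vector_Spaces.linear (smul A) (smul B) \<pi>"
  by unfold_locales (simp_all add: to_lt_add to_lt_scale)

lemma inv_to_lt [simp]: "inv \<pi> (\<pi> f) = f"
  using bij_to_lt by (simp add: bij_def)

lemma LM_to_lt: "LM B ord (\<pi> f) = A.lm f"
proof -
  have "supp B (\<pi> f) = supp A f"
    by (auto simp: supp_def std_eq coeff_to_lt)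
  then show ?thesis by (simp add: LM_def)
qed

end

text \<open>
  The nondegeneracy condition.  Given that \<open>B\<close> is an algebra of leading terms, it excludes
  the alternative that a product of standard monomials vanishes.
\<close>

locale pasl_leading = A: pasl_nonzero A ord + pasl_pair A ord B
  for A :: "('k::field, 'a::comm_ring_1, 'h) pasl" and ord :: "'h monomial rel"
    and B :: "('k, 'b::comm_ring_1, 'h) pasl" +
  assumes mon_mult_lt: "\<And>m n. m \<in> std A \<Longrightarrow> n \<in> std A \<Longrightarrow>
    mon B m * mon B n = to_lt A B (LT A ord (mon A m * mon A n))"
begin

lemma mon_mult:
  assumes "m \<in> std A" "n \<in> std A"
  shows "mon B m * mon B n = smul B (A.lc (mon A m * mon A n)) (mon B (A.mprod m n))"
  using assms A.mprod_std[OF assms] A.mon_mult_neq_0[OF assms]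
  by (simp add: mon_mult_lt LT_def to_lt_scale to_lt_mon A.mprod_def)

lemma LM_mon_mult:
  assumes "m \<in> std A" "n \<in> std A"
  shows "mon B m * mon B n \<noteq> 0" "LM B ord (mon B m * mon B n) = A.mprod m n"
proof -
  let ?t = "A.lt (mon A m * mon A n)"
  note nz = A.mon_mult_neq_0[OF assms]
  have "?t \<noteq> 0"
    using nz A.LC_neq_0[OF nz] A.LM_std[OF nz] by (simp add: LT_def)
  then show "mon B m * mon B n \<noteq> 0"
    using assms by (simp add: mon_mult_lt)
  have "A.lm ?t = A.mprod m n"
    using nz A.LC_neq_0[OF nz] A.LM_std[OF nz] by (simp add: LT_def A.LM_term A.mprod_def)
  then show "LM B ord (mon B m * mon B n) = A.mprod m n"
    using assms by (simp add: mon_mult_lt LM_to_lt)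
qed

lemma term_order_B: "pasl_term_order B ord"
  unfolding pasl_term_order_def std_eq
proof (intro conjI ballI impI)
  show "linear_order_on (std A) ord" by (rule A.lin)
  show "(0, m) \<in> ord" if "m \<in> std A" for m using that by (rule A.zero_le)
  fix f g h k
  assume "f \<in> std A" "g \<in> std A" "h \<in> std A" "k \<in> std A"
    and "(f, g) \<in> ord \<and> f \<noteq> g \<and> (h, k) \<in> ord \<and>
      mon B f * mon B h \<noteq> 0 \<and> mon B g * mon B k \<noteq> 0"
  then show "A.le (LM B ord (mon B f * mon B h)) (LM B ord (mon B g * mon B k))"
    and "LM B ord (mon B f * mon B h) \<noteq> LM B ord (mon B g * mon B k)"
    using A.mprod_less_le[of f g h k] by (simp_all add: LM_mon_mult)
qed

text \<open>
  The same order is a term order on \<open>B\<close>, with the same monoid of standard monomials, so all results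
  on leading monomials hold in \<open>B\<close> as well; in particular \<open>B\<close> is a domain.
\<close>

sublocale B: pasl_nonzero B ord
  by unfold_locales (simp_all add: term_order_B std_eq LM_mon_mult)

lemma mprod_eq: "m \<in> std A \<Longrightarrow> n \<in> std A \<Longrightarrow> B.mprod m n = A.mprod m n"
  by (simp add: B.mprod_def LM_mon_mult)

lemma to_lt_gen_mult: "\<pi> (gen_mult A ord f g) = \<pi> f * \<pi> g"
proof -
  have "\<pi> (gen_mult A ord f g) = (\<Sum>m\<in>supp A f. \<Sum>n\<in>supp A g.
      smul B (coeff A f m * coeff A g n) (mon B m * mon B n))"
    by (simp add: gen_mult_def to_lt_sum to_lt_scale mon_mult_lt A.supp_std cong: sum.cong)
  also have "\<dots> = \<pi> f * \<pi> g"
    by (simp add: to_lt_def sum_product B.scale_mult B.mult_scale mult.commute)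
  finally show ?thesis .
qed

lemma lt_iso_gen: "lt_iso_gen A ord B"
  by (simp add: lt_iso_gen_def bij_to_lt linear_to_lt to_lt_gen_mult to_lt_mon[of 0, simplified])

text \<open>
  In \<open>A\<close> the product of two leading terms can have a tail; the product in \<open>B\<close> discards it.
\<close>

lemma LT_mult: "\<pi> (A.lt (f * g)) = \<pi> (A.lt f) * \<pi> (A.lt g)"
proof (cases "f = 0 \<or> g = 0")
  case False
  then have std: "A.lm f \<in> std A" "A.lm g \<in> std A"
    by (simp_all add: A.LM_std)
  show ?thesis
    using False std A.mprod_std[OF std]
    by (simp add: LT_def A.mult_neq_0 A.mult_leading to_lt_scale to_lt_mon mon_mult
        B.scale_mult B.mult_scale ac_simps)
qed auto

text \<open>
  Divisibility in the monoid of standard monomials.  It holds whenever the exponent vectors divide,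
  but not only then, and it is what divisibility of terms in \<open>B\<close> amounts to: the cofactor of a term in a term may be
  replaced by its leading term.
\<close>

definition mdvd :: "'h monomial \<Rightarrow> 'h monomial \<Rightarrow> bool" where
  "mdvd n M \<longleftrightarrow> (\<exists>m\<in>std A. A.mprod m n = M)"

lemma LT_dvd_iff:
  assumes "g \<noteq> 0" "c \<noteq> 0" "M \<in> std A"
  shows "\<pi> (A.lt g) dvd smul B c (mon B M) \<longleftrightarrow> mdvd (A.lm g) M"
proof
  have g: "A.lm g \<in> std A" "A.lc g \<noteq> 0"
    using assms(1) by (simp_all add: A.LM_std A.LC_neq_0)
  have \<pi>: "\<pi> (A.lt g) = smul B (A.lc g) (mon B (A.lm g))"
    using assms(1) g by (simp add: LT_def to_lt_scale to_lt_mon)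
  then have g': "\<pi> (A.lt g) \<noteq> 0" "LM B ord (\<pi> (A.lt g)) = A.lm g"
    using g by (simp_all add: std_eq B.LM_term)
  assume "\<pi> (A.lt g) dvd smul B c (mon B M)"
  then obtain u where u: "smul B c (mon B M) = \<pi> (A.lt g) * u"
    by (elim dvdE)
  have cM: "smul B c (mon B M) \<noteq> 0" "LM B ord (smul B c (mon B M)) = M"
    using assms(2,3) by (simp_all add: std_eq B.LM_term)
  then have "u \<noteq> 0"
    using u by auto
  then have "M = B.mprod (A.lm g) (LM B ord u)" "LM B ord u \<in> std A"
    using u cM(2) B.LM_mult[OF g'(1), of u] g'(2) B.LM_std[of u] by (simp_all add: std_eq)
  then show "mdvd (A.lm g) M"
    unfolding mdvd_def using g(1) mprod_eq A.mprod_commute by metis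
next
  have g: "A.lm g \<in> std A" "A.lc g \<noteq> 0"
    using assms(1) by (simp_all add: A.LM_std A.LC_neq_0)
  assume "mdvd (A.lm g) M"
  then obtain m where m: "m \<in> std A" "A.mprod m (A.lm g) = M"
    by (auto simp: mdvd_def)
  let ?k = "A.lc (mon A m * mon A (A.lm g))"
  have k: "?k \<noteq> 0"
    using A.mon_mult_neq_0[OF m(1) g(1)] by (rule A.LC_neq_0)
  have "smul B c (mon B M) = \<pi> (A.lt g) * smul B (c / (?k * A.lc g)) (mon B m)"
    using assms(1) k g m
    by (simp add: LT_def to_lt_scale to_lt_mon B.scale_mult B.mult_scale mult.commute[of "mon B (A.lm g)"]
        mon_mult)
  then show "\<pi> (A.lt g) dvd smul B c (mon B M)"
    by (rule dvdI)
qed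

lemma mon_dvd_iff: "m \<in> std A \<Longrightarrow> M \<in> std A \<Longrightarrow> mon B m dvd mon B M \<longleftrightarrow> mdvd m M"
  using LT_dvd_iff[of "mon A m" 1 M] by (simp add: to_lt_mon A.LM_mon)

lemma dvd_lt_iff:
  assumes "g \<noteq> 0" "c \<noteq> 0" "M \<in> std A"
  shows "dvd_lt A B (A.lt g) (smul A c (mon A M)) \<longleftrightarrow> mdvd (A.lm g) M"
  using assms by (simp add: dvd_lt_def to_lt_scale to_lt_mon LT_dvd_iff)

lemma mdvd_refl: "m \<in> std A \<Longrightarrow> mdvd m m"
  unfolding mdvd_def by (intro bexI[of _ 0]) simp_all

lemma mdvd_le: "mdvd m n \<Longrightarrow> m \<in> std A \<Longrightarrow> A.le m n"
  by (auto simp: mdvd_def A.le_mprod)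

lemma mdvd_add:
  assumes "m \<in> std A" "m + n \<in> std A" "Poly_Mapping.keys n \<subseteq> vars A"
  shows "mdvd m (m + n)"
proof -
  have "n \<in> std A"
    using A.std_factor[OF assms(2) A.keys_std[OF assms(1)] assms(3)] .
  moreover have "A.mprod n m = m + n"
    using A.LM_mon[OF assms(2)] by (simp add: A.mprod_def A.mon_add mult.commute)
  ultimately show ?thesis
    by (auto simp: mdvd_def)
qed

section \<open>S-elements\<close>

lemma common_multiples_iff:
  assumes "p \<noteq> 0" "q \<noteq> 0"
  shows "common_multiples A ord B p q = {m \<in> std A. mdvd (A.lm p) m \<and> mdvd (A.lm q) m}"
  using LT_dvd_iff[OF assms(1), of 1] LT_dvd_iff[OF assms(2), of 1]
  by (auto simp: common_multiples_def std_eq)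

text \<open>
  Minimal common multiples do not divide each other in \<open>B\<close>, and a fortiori not as exponent
  vectors; Dickson's lemma excludes infinitely many.
\<close>

lemma finite_min_common_multiples: "finite (min_common_multiples A ord B p q)" (is "finite ?L")
proof (rule ccontr)
  assume "infinite ?L"
  then obtain l :: "nat \<Rightarrow> 'h monomial" where l: "inj l" "range l \<subseteq> ?L"
    using infinite_countable_subset by blast
  have std: "l i \<in> std A" for i
    using l(2) by (auto simp: min_common_multiples_def common_multiples_def std_eq)
  obtain i j n where n: "i < j" "Poly_Mapping.keys n \<subseteq> vars A" "l j = l i + n"
    using dickson[OF A.finite_vars, of l] A.keys_std[OF std] by blast
  have "mon B (l i) dvd mon B (l j)"
    by (simp add: n(3) B.mon_add)
  moreover have "l i \<in> ?L" "l j \<in> ?L"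
    using l(2) by blast+
  ultimately have "l i = l j"
    by (simp add: min_common_multiples_def)
  then show False
    using l(1) n(1) by (simp add: inj_eq)
qed

lemma finite_S_set: "finite (S_set A ord B p q)"
  by (simp add: S_set_def finite_min_common_multiples)

lemma min_common_multiple_exists:
  "M \<in> common_multiples A ord B p q \<Longrightarrow>
    \<exists>l\<in>min_common_multiples A ord B p q. mon B l dvd mon B M"
proof (induction M rule: wf_induct_rule[OF A.wf_less])
  case (1 M)
  show ?case
  proof (cases "M \<in> min_common_multiples A ord B p q")
    case False
    then obtain l where l: "l \<in> common_multiples A ord B p q" "mon B l dvd mon B M" "l \<noteq> M"
      using 1(2) by (auto simp: min_common_multiples_def)
    have "l \<in> std A" "M \<in> std A"
      using l(1) 1(2) by (auto simp: common_multiples_def std_eq)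
    then have "A.le l M"
      using l(2) mon_dvd_iff mdvd_le by blast
    then show ?thesis
      using 1(1)[of l] l dvd_trans by blast
  next
    case True
    then show ?thesis by (intro bexI[of _ M]) simp_all
  qed
qed

text \<open>
  The cofactor \<open>w\<close> of \<open>p\<close> in an S-element is a nonzero standard term, unique since \<open>B\<close> is a domain.
  It is normalised such that \<open>w p\<close> has leading term exactly \<open>l\<close>, so the two leading terms in an
  S-element cancel.
\<close>

lemma inv_quot_lt:
  assumes "p \<noteq> 0" "l \<in> std A" "mdvd (A.lm p) l"
  defines "w \<equiv> inv \<pi> (quot_lt A B (mon A l) (A.lt p))"
  shows "w \<noteq> 0" "A.lt (w * p) = mon A l" "A.mprod (A.lm w) (A.lm p) = l"
    "w * p - mon A l \<in> A.below l"
proof -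
  obtain m where m: "m \<in> std A" "A.mprod m (A.lm p) = l"
    using assms(3) by (auto simp: mdvd_def)
  have p: "A.lm p \<in> std A" "A.lc p \<noteq> 0"
    using assms(1) by (simp_all add: A.LM_std A.LC_neq_0)
  \<comment> \<open>The scalar by which the product of \<open>m\<close> with the leading term of \<open>p\<close> differs from \<open>l\<close> in \<open>B\<close>.\<close>
  define k where "k = A.lc (mon A m * mon A (A.lm p)) * A.lc p"
  have k: "k \<noteq> 0"
    using A.LC_neq_0[OF A.mon_mult_neq_0[OF m(1) p(1)]] p(2) by (simp add: k_def)
  define v where "v = smul A (inverse k) (mon A m)"
  have "\<pi> v * \<pi> (A.lt p) = smul B (inverse k * A.lc p) (mon B m * mon B (A.lm p))"
    using assms(1) p(1) m(1)
    by (simp add: v_def LT_def to_lt_scale to_lt_mon B.scale_mult B.mult_scale mult.commute)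
  also have "\<dots> = smul B (inverse k * k) (mon B l)"
    using p(1) m by (simp add: mon_mult k_def ac_simps)
  also have "\<dots> = \<pi> (mon A l)"
    using k assms(2) by (simp add: to_lt_mon)
  finally have v: "\<pi> v * \<pi> (A.lt p) = \<pi> (mon A l)" .
  have "quot_lt A B (mon A l) (A.lt p) = \<pi> v"
    unfolding quot_lt_def
  proof (rule the_equality)
    show "std_term B (\<pi> v) \<and> \<pi> v * \<pi> (A.lt p) = \<pi> (mon A l)"
      using v m(1) by (auto simp: std_term_def v_def to_lt_scale to_lt_mon std_eq)
    fix u assume "std_term B u \<and> u * \<pi> (A.lt p) = \<pi> (mon A l)"
    then have "(u - \<pi> v) * \<pi> (A.lt p) = 0"
      using v by (simp add: left_diff_distrib)
    moreover have "\<pi> (A.lt p) \<noteq> 0"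
      using assms(1) p by (simp add: LT_def)
    ultimately show "u = \<pi> v"
      using B.mult_neq_0[of "u - \<pi> v" "\<pi> (A.lt p)"] by auto
  qed
  then have w: "w = v"
    by (simp add: w_def)
  have ltv: "A.lt v = v"
    using m(1) by (simp add: v_def)
  show "w \<noteq> 0"
    using k m(1) by (simp add: w v_def)
  have "\<pi> (A.lt (w * p)) = \<pi> (mon A l)"
    using v ltv by (simp add: LT_mult w)
  then show lt: "A.lt (w * p) = mon A l"
    by simp
  show "A.mprod (A.lm w) (A.lm p) = l"
    using k m by (simp add: w v_def A.LM_term)
  then show "w * p - mon A l \<in> A.below l"
    using A.minus_LT_below[OF A.mult_neq_0[OF \<open>w \<noteq> 0\<close> assms(1)]] lt \<open>w \<noteq> 0\<close> assms(1)
    by (simp add: A.LM_mult)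
qed

section \<open>Division with remainder\<close>

text \<open>
  An invariant for the division algorithm.  Compared with a remainder, the bound is a fixed monomial \<open>M\<close>
  rather than \<open>LM(f)\<close>, which survives subtracting terms from \<open>f\<close>, and divisibility and compatibility are expressed
  in the monoid: between nonzero elements compatibility is automatic in a domain, so only
  the quotient by \<open>0\<close> is constrained.
\<close>

definition bounded_division ::
  "'a set \<Rightarrow> 'h monomial \<Rightarrow> 'a \<Rightarrow> ('a \<Rightarrow> 'a) \<Rightarrow> 'a \<Rightarrow> bool" where
  "bounded_division G M f h r \<longleftrightarrow>
     f = r + (\<Sum>g\<in>G. h g * g) \<and>
     (\<forall>m\<in>supp A r. \<forall>g\<in>G. g \<noteq> 0 \<longrightarrow> \<not> mdvd (A.lm g) m) \<and>
     (\<forall>g\<in>G. h g * g \<in> A.atmost M) \<and>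
     (\<forall>g\<in>G. g = 0 \<longrightarrow> h g = 0)"

lemma bounded_division_zero: "bounded_division G M 0 (\<lambda>_. 0) 0"
  by (simp add: bounded_division_def A.subspace_0 A.subspace_atmost)

lemma bounded_division_mono:
  "bounded_division G M f h r \<Longrightarrow> A.le M N \<Longrightarrow> bounded_division G N f h r"
  unfolding bounded_division_def using A.atmost_mono by blast

lemma bounded_division_add_quotient:
  assumes P: "bounded_division G M (f - t * g) h r"
    and g: "finite G" "g \<in> G" "g \<noteq> 0" and t: "t * g \<in> A.atmost M"
  shows "bounded_division G M f (h(g := h g + t)) r"
proof -
  let ?h = "h(g := h g + t)"
  have "(\<Sum>x\<in>G. ?h x * x) = (\<Sum>x\<in>G. h x * x + (if x = g then t * g else 0))"
    by (intro sum.cong) (auto simp: algebra_simps)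
  also have "\<dots> = (\<Sum>x\<in>G. h x * x) + t * g"
    using g by (simp add: sum.distrib)
  finally have sum: "(\<Sum>x\<in>G. ?h x * x) = (\<Sum>x\<in>G. h x * x) + t * g" .
  have "f - t * g = r + (\<Sum>x\<in>G. h x * x)"
    using P by (simp add: bounded_division_def)
  then have "f = r + (\<Sum>x\<in>G. ?h x * x)"
    unfolding sum by (simp add: diff_eq_eq add.assoc)
  moreover have "?h x * x \<in> A.atmost M" if "x \<in> G" for x
    using P that t
    by (auto simp: bounded_division_def distrib_right intro: A.subspace_add[OF A.subspace_atmost])
  ultimately show ?thesis
    using P g(3) unfolding bounded_division_def by auto
qed

lemma bounded_division_add_remainder:
  assumes P: "bounded_division G M (f - smul A c (mon A N)) h r"
    and N: "N \<in> std A" "\<And>g. g \<in> G \<Longrightarrow> g \<noteq> 0 \<Longrightarrow> \<not> mdvd (A.lm g) N"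
  shows "bounded_division G M f h (r + smul A c (mon A N))"
proof -
  have "supp A (r + smul A c (mon A N)) \<subseteq> supp A r \<union> {N}"
    using A.supp_add_subset[of r "smul A c (mon A N)"] N(1)
    by (cases "c = 0") (auto simp: A.supp_scale A.supp_mon)
  moreover have "f - smul A c (mon A N) = r + (\<Sum>g\<in>G. h g * g)"
    using P by (simp add: bounded_division_def)
  then have "f = r + smul A c (mon A N) + (\<Sum>g\<in>G. h g * g)"
    by (simp add: diff_eq_eq ac_simps)
  ultimately show ?thesis
    using P N(2) unfolding bounded_division_def by blast
qed

text \<open>
  If \<open>M\<close> is divisible by some \<open>LM(g)\<close>, subtract a multiple of \<open>g\<close>; otherwise move the term at \<open>M\<close> to
  the remainder.  Either way the coefficient at \<open>M\<close> disappears, and the order is well-founded.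
\<close>

lemma bounded_division_exists:
  assumes "finite G" "M \<in> std A" "f \<in> A.atmost M"
  shows "\<exists>h r. bounded_division G M f h r"
  using assms(2,3)
proof (induction M arbitrary: f rule: wf_induct_rule[OF A.wf_less])
  case (1 M f)
  have smaller: "\<exists>h r. bounded_division G M f h r" if f: "f \<in> A.below M" for f
  proof (cases "f = 0")
    case True
    then show ?thesis using bounded_division_zero by blast
  next
    case False
    then have less: "A.less (A.lm f) M"
      using f A.below_iff by blast
    then have "\<exists>h r. bounded_division G (A.lm f) f h r"
      by (intro 1(1)) (simp_all add: A.LM_std[OF False] A.atmost_LM)
    then show ?thesis
      using less bounded_division_mono by blast
  qed
  let ?c = "coeff A f M"
  show ?case
  proof (cases "\<exists>g\<in>G. g \<noteq> 0 \<and> mdvd (A.lm g) M")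
    case True
    then obtain g m where g: "g \<in> G" "g \<noteq> 0" and m: "m \<in> std A" "A.mprod m (A.lm g) = M"
      by (auto simp: mdvd_def)
    let ?x = "mon A m * g"
    have x: "?x \<noteq> 0" "A.lm ?x = M"
      using g m by (simp_all add: A.mult_neq_0 A.LM_mult A.LM_mon)
    define t where "t = smul A (?c / coeff A ?x M) (mon A m)"
    have tg: "t * g = smul A (?c / coeff A ?x M) ?x"
      by (simp add: t_def A.scale_mult)
    have tg_atmost: "t * g \<in> A.atmost M"
      unfolding tg using A.atmost_LM[of ?x] x(2) by (simp add: A.subspace_scale[OF A.subspace_atmost])
    have "coeff A ?x M \<noteq> 0"
      using A.LC_neq_0[OF x(1)] x(2) by (simp add: LC_def)
    then have "coeff A (f - t * g) M = 0"
      unfolding tg by (simp add: A.coeff_diff A.coeff_scale)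
    then have "f - t * g \<in> A.below M"
      using A.atmost_coeff[OF A.subspace_diff[OF A.subspace_atmost 1(3) tg_atmost] 1(2)] by blast
    then show ?thesis
      using smaller bounded_division_add_quotient[OF _ assms(1) g tg_atmost] by blast
  next
    case False
    have cM: "smul A ?c (mon A M) \<in> A.atmost M"
      using 1(2) by (intro A.subspace_scale[OF A.subspace_atmost])
        (simp add: A.atmost_def A.supp_mon A.le_refl)
    have "coeff A (f - smul A ?c (mon A M)) M = 0"
      using 1(2) by (simp add: A.coeff_diff A.coeff_scale A.coeff_mon)
    then have "f - smul A ?c (mon A M) \<in> A.below M"
      using A.atmost_coeff[OF A.subspace_diff[OF A.subspace_atmost 1(3) cM] 1(2)] by blast
    then obtain h r where "bounded_division G M (f - smul A ?c (mon A M)) h r"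
      using smaller by blast
    then have "bounded_division G M f h (r + smul A ?c (mon A M))"
      by (rule bounded_division_add_remainder[OF _ 1(2)]) (use False in blast)
    then show ?thesis by blast
  qed
qed

lemma remainder_exists:
  assumes "finite G"
  shows "\<exists>r. is_remainder A ord B G f r"
proof (cases "f = 0")
  case True
  then have "is_remainder A ord B G f 0"
    unfolding is_remainder_def by (intro exI[of _ "\<lambda>_. 0"]) (simp add: compatible_def)
  then show ?thesis by blast
next
  case False
  obtain h r where "bounded_division G (A.lm f) f h r"
    using bounded_division_exists[OF assms A.LM_std[OF False] A.atmost_LM] by blast
  then have rh: "f = r + (\<Sum>g\<in>G. h g * g)"
    "\<And>m g. m \<in> supp A r \<Longrightarrow> g \<in> G \<Longrightarrow> g \<noteq> 0 \<Longrightarrow> \<not> mdvd (A.lm g) m"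
    "\<And>g. g \<in> G \<Longrightarrow> h g * g \<in> A.atmost (A.lm f)" "\<And>g. g \<in> G \<Longrightarrow> g = 0 \<Longrightarrow> h g = 0"
    unfolding bounded_division_def by blast+
  have "is_remainder A ord B G f r"
    unfolding is_remainder_def
  proof (intro exI[of _ h] conjI ballI impI)
    show "f = r + (\<Sum>g\<in>G. h g * g)" by fact
    show "f \<noteq> 0" by fact
    show "\<not> dvd_lt A B (A.lt g) (smul A (coeff A r m) (mon A m))" if m: "m \<in> supp A r" "g \<in> G" for m g
    proof -
      have m': "m \<in> std A" "coeff A r m \<noteq> 0"
        using m(1) by (simp_all add: supp_def)
      show ?thesis
        using rh(2)[OF m] m' by (cases "g = 0") (simp_all add: dvd_lt_iff, simp add: dvd_lt_def)
    qed
    show "A.le (A.lm (h g * g)) (A.lm f)" if "g \<in> G" "h g * g \<noteq> 0" for g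
      using rh(3)[OF that(1)] A.atmost_iff[OF that(2)] by blast
    show "compatible A B (h g) (A.lt g)" if "g \<in> G" for g
    proof (cases "g = 0")
      case True
      then show ?thesis using rh(4)[OF that] by (simp add: compatible_def)
    next
      case False
      have "A.lt g \<noteq> 0"
        using False A.LM_std[OF False] A.LC_neq_0[OF False] by (simp add: LT_def)
      then have "mon B m * \<pi> (A.lt g) \<noteq> 0" if "m \<in> std A" for m
        using that by (intro B.mult_neq_0) (simp_all add: std_eq)
      then show ?thesis
        by (simp add: compatible_def to_lt_mon A.supp_std)
    qed
  qed
  then show ?thesis by blast
qed

lemma remainder_not_dvd:
  assumes "is_remainder A ord B G f r" "r \<noteq> 0" "g \<in> G" "g \<noteq> 0"
  shows "\<not> mdvd (A.lm g) (A.lm r)"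
  using assms A.LM_in_supp[OF assms(2)] dvd_lt_iff[OF assms(4), of "coeff A r (A.lm r)" "A.lm r"]
  unfolding is_remainder_def by (auto simp: supp_def)


section \<open>Buchberger's criterion\<close>

text \<open>
  Multiples by standard monomials span the ideal over the field, which reduces membership in the
  ideal to linear algebra.
\<close>

definition multiples :: "'a set \<Rightarrow> 'a set" where
  "multiples G = {mon A m * g | m g. m \<in> std A \<and> g \<in> G \<and> g \<noteq> 0}"

abbreviation span_below :: "'a set \<Rightarrow> 'h monomial \<Rightarrow> 'a set" where
  "span_below G M \<equiv> A.span {z \<in> multiples G. A.less (A.lm z) M}"

lemma mult_expand: "w * g = (\<Sum>m\<in>supp A w. smul A (coeff A w m) (mon A m * g))"
proof -
  have "w * g = (\<Sum>m\<in>supp A w. smul A (coeff A w m) (mon A m)) * g"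
    using A.expand[of w] by simp
  then show ?thesis by (simp add: sum_distrib_right A.scale_mult)
qed

text \<open>
  Expanding \<open>w\<close> into terms gives multiples of \<open>g\<close> whose leading monomials do not exceed \<open>LM(wg)\<close>, since
  nothing cancels at the top.
\<close>

lemma mult_in_span_below:
  assumes "g \<in> G" "w * g \<in> A.below M"
  shows "w * g \<in> span_below G M"
proof (cases "w = 0 \<or> g = 0")
  case True
  then show ?thesis by (auto simp: A.span_zero)
next
  case False
  have "mon A m * g \<in> {z \<in> multiples G. A.less (A.lm z) M}" if m: "m \<in> supp A w" for m
  proof -
    have std: "m \<in> std A"
      using m by (rule A.supp_std)
    have "A.le (A.lm (mon A m * g)) (A.lm (w * g))"
      using False std A.supp_le_LM[OF m] A.LM_std[of g]
      by (simp add: A.LM_mult A.LM_mon A.mprod_le_le A.le_refl)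
    moreover have "A.less (A.lm (w * g)) M"
      using assms(2) A.below_iff[of "w * g" M] A.mult_neq_0[of w g] False by blast
    ultimately have "A.less (A.lm (mon A m * g)) M"
      by (rule A.le_less_trans)
    then show ?thesis
      using std assms(1) False by (auto simp: multiples_def)
  qed
  then show ?thesis
    unfolding mult_expand[of w g] by (intro A.span_sum A.span_scale A.span_base)
qed

lemma leading_multiple:
  assumes "g \<in> G" "g \<noteq> 0" "w \<noteq> 0"
  shows "w * g - smul A (A.lc w) (mon A (A.lm w) * g) \<in> span_below G (A.mprod (A.lm w) (A.lm g))"
proof -
  have "(w - A.lt w) * g \<in> A.below (A.mprod (A.lm w) (A.lm g))"
    using A.mult_below_atmost[OF A.minus_LT_below[OF assms(3)] A.atmost_LM] .
  then have "(w - A.lt w) * g \<in> span_below G (A.mprod (A.lm w) (A.lm g))"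
    by (rule mult_in_span_below[OF assms(1)])
  then show ?thesis
    using assms(3) by (simp add: LT_def left_diff_distrib A.scale_mult)
qed

text \<open>
  The representation provided by a zero remainder has all its leading monomials below \<open>l\<close>; by strict
  monotonicity, multiplying it by \<open>e\<close> brings them below \<open>e \<cdot> l\<close>.
\<close>

lemma zero_remainder_span_below:
  assumes "finite G" "is_remainder A ord B G s 0" "s \<in> A.below l" "e \<in> std A"
  shows "mon A e * s \<in> span_below G (A.mprod e l)"
proof -
  obtain h where h: "s = (\<Sum>g\<in>G. h g * g)"
    "\<And>g. g \<in> G \<Longrightarrow> h g * g \<noteq> 0 \<Longrightarrow> s \<noteq> 0 \<and> A.le (A.lm (h g * g)) (A.lm s)"
    using assms(2) unfolding is_remainder_def by auto
  have "mon A e * (h g * g) \<in> span_below G (A.mprod e l)" if g: "g \<in> G" for g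
  proof -
    have "h g * g \<in> A.below l"
    proof (cases "h g * g = 0")
      case True
      then show ?thesis by (simp add: A.below_def)
    next
      case False
      then have "s \<noteq> 0" "A.le (A.lm (h g * g)) (A.lm s)"
        using h(2)[OF g] by blast+
      then show ?thesis
        using assms(3) A.below_iff[OF False] A.below_iff[of s l] A.le_less_trans by blast
    qed
    moreover have "mon A e \<in> A.atmost e"
      using assms(4) by (simp add: A.atmost_def A.supp_mon A.le_refl)
    ultimately have "h g * g * mon A e \<in> A.below (A.mprod l e)"
      by (rule A.mult_below_atmost)
    then have "(mon A e * h g) * g \<in> A.below (A.mprod e l)"
      by (simp add: A.mprod_commute ac_simps)
    then have "(mon A e * h g) * g \<in> span_below G (A.mprod e l)"
      by (rule mult_in_span_below[OF g])
    then show ?thesis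
      by (simp only: mult.assoc)
  qed
  then show ?thesis
    unfolding h(1) sum_distrib_left by (intro A.span_sum)
qed

text \<open>
  Let \<open>x = m p\<close> and \<open>y = n q\<close> have the common leading monomial \<open>M\<close>.  It is a common multiple of \<open>LM(p)\<close>
  and \<open>LM(q)\<close>, so \<open>M = e \<cdot> l\<close> for a minimal one \<open>l\<close>.  Multiply the S-element \<open>v p - w q\<close> at \<open>l\<close> by \<open>e\<close>.
  The products \<open>e v\<close> and \<open>e w\<close> are in general not terms in \<open>A\<close>, but by cancellation in the monoid their
  leading monomials are \<open>m\<close> and \<open>n\<close>, and their tails contribute only multiples of \<open>p\<close> and \<open>q\<close> below \<open>M\<close>.
  So some \<open>c x - c' y\<close> agrees with the multiple of the S-element up to smaller multiples, and the
  latter is a combination of smaller multiples because the S-element has remainder zero.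
\<close>

lemma buchberger_cancel:
  assumes "finite G"
    and S: "\<forall>p\<in>G. \<forall>q\<in>G. \<forall>s\<in>S_set A ord B p q. is_remainder A ord B G s 0"
    and xy: "x \<in> multiples G" "y \<in> multiples G" "A.lm x = A.lm y"
  shows "\<exists>c c'. c \<noteq> 0 \<and> smul A c x - smul A c' y \<in> span_below G (A.lm x)"
proof -
  obtain m p where x: "x = mon A m * p" "m \<in> std A" "p \<in> G" "p \<noteq> 0"
    using xy(1) by (auto simp: multiples_def)
  obtain n q where y: "y = mon A n * q" "n \<in> std A" "q \<in> G" "q \<noteq> 0"
    using xy(2) by (auto simp: multiples_def)
  let ?M = "A.lm x"
  have pq: "A.lm p \<in> std A" "A.lm q \<in> std A"
    using x y A.LM_std by blast+
  have M: "A.mprod m (A.lm p) = ?M" "A.mprod n (A.lm q) = ?M"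
    using x y xy(3) by (simp_all add: A.LM_mult A.LM_mon)
  then have Mstd: "?M \<in> std A"
    using x(2) pq(1) A.mprod_std by metis
  have "mdvd (A.lm p) ?M" "mdvd (A.lm q) ?M"
    unfolding mdvd_def using M x(2) y(2) by blast+
  then have "?M \<in> common_multiples A ord B p q"
    using Mstd x(4) y(4) by (simp add: common_multiples_iff)
  then obtain l where l: "l \<in> min_common_multiples A ord B p q" "mon B l dvd mon B ?M"
    using min_common_multiple_exists by blast
  have l': "l \<in> std A" "mdvd (A.lm p) l" "mdvd (A.lm q) l"
    using l(1) x(4) y(4) by (simp_all add: min_common_multiples_def common_multiples_iff)
  then obtain e where e: "e \<in> std A" "A.mprod e l = ?M"
    using l(2) Mstd mon_dvd_iff by (auto simp: mdvd_def)
  define v where "v = inv \<pi> (quot_lt A B (mon A l) (A.lt p))"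
  define w where "w = inv \<pi> (quot_lt A B (mon A l) (A.lt q))"
  note v = inv_quot_lt[OF x(4) l'(1,2), folded v_def]
  note w = inv_quot_lt[OF y(4) l'(1,3), folded w_def]
  let ?s = "v * p - w * q"
  have "?s \<in> S_set A ord B p q"
    using l(1) x(4) y(4) by (auto simp: S_set_def v_def w_def)
  then have "is_remainder A ord B G ?s 0"
    using S x(3) y(3) by blast
  moreover have "?s \<in> A.below l"
    using A.subspace_diff[OF A.subspace_below v(4) w(4)] by simp
  ultimately have s: "mon A e * ?s \<in> span_below G ?M"
    using zero_remainder_span_below[OF assms(1) _ _ e(1), of ?s l] e(2) by simp
  \<comment> \<open>Cancel \<open>LM(g)\<close> in \<open>(e \<cdot> LM(u)) \<cdot> LM(g) = e \<cdot> l = M = k \<cdot> LM(g)\<close>.\<close>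
  have top: "A.lm (mon A e * u) = k" "mon A e * u \<noteq> 0"
    if "u \<noteq> 0" "A.mprod (A.lm u) (A.lm g) = l" "A.mprod k (A.lm g) = ?M" "k \<in> std A" "A.lm g \<in> std A"
    for u g k
  proof -
    show "mon A e * u \<noteq> 0"
      using that(1) e(1) by (simp add: A.mult_neq_0)
    have lmu: "A.lm u \<in> std A"
      using that(1) by (rule A.LM_std)
    have "A.mprod (A.mprod e (A.lm u)) (A.lm g) = A.mprod k (A.lm g)"
      using that e by (simp add: A.mprod_assoc lmu)
    then have "A.mprod e (A.lm u) = k"
      using A.mprod_cancel[OF A.mprod_std[OF e(1) lmu] that(4,5)] by blast
    then show "A.lm (mon A e * u) = k"
      using that(1) e(1) by (simp add: A.LM_mult A.LM_mon)
  qed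
  note tv = top[OF v(1,3) M(1) x(2) pq(1)] and tw = top[OF w(1,3) M(2) y(2) pq(2)]
  let ?c = "A.lc (mon A e * v)" and ?c' = "A.lc (mon A e * w)"
  have V: "mon A e * v * p - smul A ?c x \<in> span_below G ?M"
    using leading_multiple[OF x(3,4) tv(2)] tv(1) M(1) x(1) by simp
  have W: "mon A e * w * q - smul A ?c' y \<in> span_below G ?M"
    using leading_multiple[OF y(3,4) tw(2)] tw(1) M(2) y(1) by simp
  have "smul A ?c x - smul A ?c' y = mon A e * ?s - (mon A e * v * p - smul A ?c x)
      + (mon A e * w * q - smul A ?c' y)"
    by (simp add: algebra_simps)
  also have "\<dots> \<in> span_below G ?M"
    by (intro A.span_add A.span_diff s V W)
  finally show ?thesis
    using A.LC_neq_0[OF tv(2)] by blast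
qed

lemma ideal_gen_subset_span: "ideal_gen G \<subseteq> A.span (multiples G)"
proof
  interpret ideal: module "(*) :: 'a \<Rightarrow> 'a \<Rightarrow> 'a" by (rule module_mult)
  fix f assume "f \<in> ideal_gen G"
  then show "f \<in> A.span (multiples G)"
  proof (induction rule: ideal.span_induct_alt)
    case base
    show ?case by (rule A.span_zero)
  next
    case (step w g f)
    have "w * g \<in> A.span (multiples G)"
    proof (cases "g = 0")
      case True
      then show ?thesis by (simp add: A.span_zero)
    next
      case False
      then have "mon A m * g \<in> multiples G" if "m \<in> supp A w" for m
        using that A.supp_std step(1) by (auto simp: multiples_def)
      then show ?thesis
        unfolding mult_expand[of w g] by (intro A.span_sum A.span_scale A.span_base)
    qed
    then show ?case using step by (intro A.span_add)
  qed
qed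

lemma buchberger:
  assumes "finite G"
    and S: "\<forall>p\<in>G. \<forall>q\<in>G. \<forall>s\<in>S_set A ord B p q. is_remainder A ord B G s 0"
    and f: "f \<in> ideal_gen G" "f \<noteq> 0"
  shows "\<exists>g\<in>G. g \<noteq> 0 \<and> mdvd (A.lm g) (A.lm f)"
proof -
  have "\<exists>x\<in>multiples G. A.lm f = A.lm x"
  proof (rule A.span_leading)
    show "x \<noteq> 0" if "x \<in> multiples G" for x
      using that A.mult_neq_0 by (force simp: multiples_def)
    show "\<exists>c c'. c \<noteq> 0 \<and> smul A c x - smul A c' y \<in> span_below G (A.lm x)"
      if "x \<in> multiples G" "y \<in> multiples G" "A.lm x = A.lm y" for x y
      using assms(1) S that by (rule buchberger_cancel)
    show "f \<in> A.span (multiples G)"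
      using f(1) ideal_gen_subset_span by blast
  qed fact
  then obtain m g where "m \<in> std A" "g \<in> G" "g \<noteq> 0" "A.lm f = A.lm (mon A m * g)"
    by (auto simp: multiples_def)
  then show ?thesis
    by (intro bexI[of _ g]) (auto simp: mdvd_def A.LM_mult A.LM_mon)
qed

lemma groebner_basisI:
  assumes "G \<subseteq> I"
    and dvd: "\<And>f. f \<in> I \<Longrightarrow> f \<noteq> 0 \<Longrightarrow> \<exists>g\<in>G. g \<noteq> 0 \<and> mdvd (A.lm g) (A.lm f)"
  shows "groebner_basis A ord B I G"
  unfolding groebner_basis_def
proof (intro conjI equalityI assms(1))
  interpret ideal: module "(*) :: 'b \<Rightarrow> 'b \<Rightarrow> 'b" by (rule module_mult)
  let ?L = "\<lambda>f. \<pi> (A.lt f)"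
  show "ideal_gen (?L ` G) \<subseteq> ideal_gen (?L ` I)"
    using assms(1) by (intro ideal.span_mono image_mono)
  have "?L f \<in> ideal_gen (?L ` G)" if f: "f \<in> I" for f
  proof (cases "f = 0")
    case True
    then show ?thesis by (simp add: ideal.span_zero)
  next
    case False
    then obtain g where g: "g \<in> G" "g \<noteq> 0" "mdvd (A.lm g) (A.lm f)"
      using dvd[OF f] by blast
    have "?L f = smul B (A.lc f) (mon B (A.lm f))"
      using False A.LM_std[OF False] by (simp add: LT_def to_lt_scale to_lt_mon)
    then have "?L g dvd ?L f"
      using LT_dvd_iff[OF g(2) A.LC_neq_0[OF False] A.LM_std[OF False]] g(3) by simp
    then obtain u where "?L f = u * ?L g"
      by (auto simp: mult.commute elim: dvdE)
    then show ?thesis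
      using g(1) by (simp add: ideal.span_scale ideal.span_base)
  qed
  then show "ideal_gen (?L ` I) \<subseteq> ideal_gen (?L ` G)"
    by (intro ideal.span_minimal ideal.subspace_span) auto
qed

section \<open>The S-closure algorithm\<close>

lemma S_pass_ideal:
  assumes "S_pass A ord B G G'" "finite G"
  shows "finite G'" "G \<subseteq> G'" "G' \<subseteq> ideal_gen G"
proof -
  interpret ideal: module "(*) :: 'a \<Rightarrow> 'a \<Rightarrow> 'a" by (rule module_mult)
  obtain \<rho> where rem: "\<And>p q s. p \<in> G \<Longrightarrow> q \<in> G \<Longrightarrow> s \<in> S_set A ord B p q \<Longrightarrow>
      is_remainder A ord B G s (\<rho> p q s)"
    and G': "G' = G \<union> {\<rho> p q s | p q s.
      p \<in> G \<and> q \<in> G \<and> s \<in> S_set A ord B p q \<and> \<rho> p q s \<noteq> 0}"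
    using assms(1) unfolding S_pass_def by blast
  have "G' \<subseteq> G \<union> (\<Union>p\<in>G. \<Union>q\<in>G. \<rho> p q ` S_set A ord B p q)"
    unfolding G' by blast
  then show "finite G'"
    by (rule finite_subset) (simp add: assms(2) finite_S_set)
  show "G \<subseteq> G'"
    unfolding G' by blast
  have "\<rho> p q s \<in> ideal_gen G" if pqs: "p \<in> G" "q \<in> G" "s \<in> S_set A ord B p q" for p q s
  proof -
    obtain h where "s = \<rho> p q s + (\<Sum>g\<in>G. h g * g)"
      using rem[OF pqs] unfolding is_remainder_def by blast
    then have "\<rho> p q s = s - (\<Sum>g\<in>G. h g * g)"
      by (simp add: algebra_simps)
    moreover have "u * p - v * q \<in> ideal_gen G" for u v
      using pqs(1,2) by (intro ideal.span_diff ideal.span_scale ideal.span_base)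
    then have "s \<in> ideal_gen G"
      using pqs(3) by (auto simp: S_set_def split: if_splits)
    moreover have "(\<Sum>g\<in>G. h g * g) \<in> ideal_gen G"
      by (intro ideal.span_sum ideal.span_scale ideal.span_base)
    ultimately show ?thesis
      by (simp add: ideal.span_diff)
  qed
  then show "G' \<subseteq> ideal_gen G"
    unfolding G' using ideal.span_superset[of G] by blast
qed

lemma S_reachable:
  assumes "(S_continue A ord B)\<^sup>*\<^sup>* F G" "finite F"
  shows "finite G \<and> F \<subseteq> G \<and> G \<subseteq> ideal_gen F"
  using assms(1)
proof (induction rule: rtranclp_induct)
  interpret ideal: module "(*) :: 'a \<Rightarrow> 'a \<Rightarrow> 'a" by (rule module_mult)
  case base
  show ?case using assms(2) ideal.span_superset by blast
next
  interpret ideal: module "(*) :: 'a \<Rightarrow> 'a \<Rightarrow> 'a" by (rule module_mult)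
  case (step G G')
  then have pass: "S_pass A ord B G G'"
    by (simp add: S_continue_def)
  have "ideal_gen G \<subseteq> ideal_gen F"
    using step.IH by (intro ideal.span_minimal ideal.subspace_span) blast
  then show ?case
    using S_pass_ideal[OF pass] step.IH by blast
qed

text \<open>
  A round that changes the set adds a nonzero remainder, whose leading monomial is divisible by
  no earlier one.
\<close>

lemma S_continue_new:
  assumes "S_continue A ord B G G'"
  shows "\<exists>r\<in>G'. r \<noteq> 0 \<and> (\<forall>g\<in>G. g \<noteq> 0 \<longrightarrow> \<not> mdvd (A.lm g) (A.lm r))"
proof -
  obtain \<rho> where rem: "\<And>p q s. p \<in> G \<Longrightarrow> q \<in> G \<Longrightarrow> s \<in> S_set A ord B p q \<Longrightarrow>
      is_remainder A ord B G s (\<rho> p q s)"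
    and G': "G' = G \<union> {\<rho> p q s | p q s.
      p \<in> G \<and> q \<in> G \<and> s \<in> S_set A ord B p q \<and> \<rho> p q s \<noteq> 0}"
    and "G' \<noteq> G"
    using assms unfolding S_continue_def S_pass_def by blast
  then obtain p q s where pqs: "p \<in> G" "q \<in> G" "s \<in> S_set A ord B p q" "\<rho> p q s \<noteq> 0"
    by blast
  then have "\<rho> p q s \<in> G'"
    unfolding G' by blast
  then show ?thesis
    using remainder_not_dvd[OF rem[OF pqs(1-3)] pqs(4)] pqs(4) by blast
qed

text \<open>
  The new leading monomials of an infinite run would contradict Dickson's lemma, because divisibility of
  exponent vectors implies divisibility in the monoid.
\<close>

lemma no_infinite_run: "\<not> (\<forall>n. S_continue A ord B (Gs n) (Gs (Suc n)))"
proof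
  assume run: "\<forall>n. S_continue A ord B (Gs n) (Gs (Suc n))"
  have "\<forall>n. \<exists>r. r \<in> Gs (Suc n) \<and> r \<noteq> 0 \<and> (\<forall>g\<in>Gs n. g \<noteq> 0 \<longrightarrow> \<not> mdvd (A.lm g) (A.lm r))"
    using S_continue_new run by blast
  then obtain r where r: "\<And>n. r n \<in> Gs (Suc n)" "\<And>n. r n \<noteq> 0"
    "\<And>n g. g \<in> Gs n \<Longrightarrow> g \<noteq> 0 \<Longrightarrow> \<not> mdvd (A.lm g) (A.lm (r n))"
    by metis
  have mono: "Gs m \<subseteq> Gs n" if "m \<le> n" for m n
    using that
  proof (rule lift_Suc_mono_le[of Gs, rotated])
    show "Gs n \<subseteq> Gs (Suc n)" for n
      using run unfolding S_continue_def S_pass_def by blast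
  qed
  have std: "A.lm (r i) \<in> std A" for i
    using r(2) by (rule A.LM_std)
  obtain i j n where n: "i < j" "Poly_Mapping.keys n \<subseteq> vars A" "A.lm (r j) = A.lm (r i) + n"
    using dickson[OF A.finite_vars, of "\<lambda>i. A.lm (r i)"] A.keys_std[OF std] by blast
  have "mdvd (A.lm (r i)) (A.lm (r j))"
    using mdvd_add[of "A.lm (r i)" n] n std[of i] std[of j] by simp
  moreover have "r i \<in> Gs j"
    using r(1)[of i] mono[of "Suc i" j] n(1) by auto
  ultimately show False
    using r(2,3) by blast
qed

lemma S_terminates:
  assumes "finite F"
  shows "S_terminates A ord B F"
  unfolding S_terminates_def
  using S_reachable[OF _ assms] finite_S_set remainder_exists no_infinite_run by blast

text \<open>
  When a round changes nothing, every nonzero remainder it computed would already belong to \<open>G\<close> and be divisible by its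
  own leading term; so all remainders are zero and Buchberger's criterion applies.
\<close>

lemma S_output_groebner_basis:
  assumes "finite F" "S_output A ord B F G"
  shows "groebner_basis A ord B (ideal_gen F) G"
proof (rule groebner_basisI)
  interpret ideal: module "(*) :: 'a \<Rightarrow> 'a \<Rightarrow> 'a" by (rule module_mult)
  have reach: "finite G" "F \<subseteq> G" "G \<subseteq> ideal_gen F"
    using S_reachable[OF _ assms(1)] assms(2) unfolding S_output_def by blast+
  show "G \<subseteq> ideal_gen F" by fact
  obtain \<rho> where rem: "\<And>p q s. p \<in> G \<Longrightarrow> q \<in> G \<Longrightarrow> s \<in> S_set A ord B p q \<Longrightarrow>
      is_remainder A ord B G s (\<rho> p q s)"
    and G: "G = G \<union> {\<rho> p q s | p q s.
      p \<in> G \<and> q \<in> G \<and> s \<in> S_set A ord B p q \<and> \<rho> p q s \<noteq> 0}"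
    using assms(2) unfolding S_output_def S_pass_def by blast
  have zero: "\<forall>p\<in>G. \<forall>q\<in>G. \<forall>s\<in>S_set A ord B p q. is_remainder A ord B G s 0"
  proof (intro ballI)
    fix p q s
    assume pqs: "p \<in> G" "q \<in> G" "s \<in> S_set A ord B p q"
    have "\<rho> p q s = 0"
    proof (rule ccontr)
      assume nz: "\<rho> p q s \<noteq> 0"
      then have "\<rho> p q s \<in> G"
        using pqs by (subst G) blast
      then show False
        using remainder_not_dvd[OF rem[OF pqs] nz] nz mdvd_refl[OF A.LM_std[OF nz]] by blast
    qed
    then show "is_remainder A ord B G s 0" using rem[OF pqs] by simp
  qed
  fix f assume "f \<in> ideal_gen F" "f \<noteq> 0"
  then show "\<exists>g\<in>G. g \<noteq> 0 \<and> mdvd (A.lm g) (A.lm f)"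
    using buchberger[OF reach(1) zero, of f] ideal.span_mono[OF reach(2)] by blast
qed

end

section \<open>Recognising the nondegenerate case\<close>

context pasl_pair
begin

text \<open>
  In a domain the products of standard monomials are nonzero, which leaves only the second of the two
  alternatives in the definition of an algebra of leading terms.
\<close>

lemma leading_iff_domain:
  assumes "lt_algebra A ord B"
  shows "ring_is_domain TYPE('b) \<longleftrightarrow> pasl_leading A ord B"
proof
  assume dom: "ring_is_domain TYPE('b)"
  have lt: "mon B m * mon B n = \<pi> (A.lt (mon A m * mon A n))"
    and nz: "mon A m * mon A n \<noteq> 0" if mn: "m \<in> std A" "n \<in> std A" for m n
  proof -
    have "mon B m * mon B n \<noteq> 0"
      using dom mn B.mon_neq_0 unfolding ring_is_domain_def std_eq by blast
    moreover have "mon B m * mon B n \<in> {0, \<pi> (A.lt (mon A m * mon A n))}"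
      using assms mn by (auto simp: lt_algebra_def to_lt_mon)
    ultimately show "mon B m * mon B n = \<pi> (A.lt (mon A m * mon A n))"
      and "mon A m * mon A n \<noteq> 0"
      by auto
  qed
  show "pasl_leading A ord B"
    by unfold_locales (fact nz lt)+
next
  assume "pasl_leading A ord B"
  then interpret pasl_leading A ord B .
  show "ring_is_domain TYPE('b)" by (rule B.domain)
qed

text \<open>
  An isomorphism with the generic algebra prescribes the products of standard monomials in \<open>B\<close>
  to be the leading terms of the products in \<open>A\<close>.
\<close>

lemma leading_iff_iso_gen:
  "ring_is_domain TYPE('a) \<and> lt_iso_gen A ord B \<longleftrightarrow> pasl_leading A ord B"
proof
  assume *: "ring_is_domain TYPE('a) \<and> lt_iso_gen A ord B"
  have nz: "mon A m * mon A n \<noteq> 0" if "m \<in> std A" "n \<in> std A" for m n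
    using * that A.mon_neq_0 unfolding ring_is_domain_def by blast
  have lt: "mon B m * mon B n = \<pi> (A.lt (mon A m * mon A n))" if mn: "m \<in> std A" "n \<in> std A" for m n
  proof -
    have "gen_mult A ord (mon A m) (mon A n) = A.lt (mon A m * mon A n)"
      using mn by (simp add: gen_mult_def A.supp_mon A.coeff_mon)
    moreover have "\<pi> (gen_mult A ord (mon A m) (mon A n)) = \<pi> (mon A m) * \<pi> (mon A n)"
      using * by (simp add: lt_iso_gen_def)
    ultimately show ?thesis
      using mn by (simp add: to_lt_mon)
  qed
  show "pasl_leading A ord B"
    by unfold_locales (fact nz lt)+
next
  assume "pasl_leading A ord B"
  then interpret pasl_leading A ord B .
  show "ring_is_domain TYPE('a) \<and> lt_iso_gen A ord B"
    using A.domain lt_iso_gen by blast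
qed

end

theorem corollary6p8:
  fixes A :: "('k::field, 'a::comm_ring_1, 'h) pasl"
    and ord :: "'h monomial rel"
    and B :: "('k, 'b::comm_ring_1, 'h) pasl"
  assumes "pseudo_asl A"
    and "pasl_term_order A ord"
    and "lt_algebra A ord B"
  shows "(ring_is_domain TYPE('b) \<longleftrightarrow> ring_is_domain TYPE('a) \<and> lt_iso_gen A ord B) \<and>
    (ring_is_domain TYPE('b) \<longrightarrow>
       (\<forall>fs :: 'a list.
          S_terminates A ord B (set fs) \<and>
          (\<forall>G. S_output A ord B (set fs) G \<longrightarrow>
               groebner_basis A ord B (ideal_gen (set fs)) G)))"
proof -
  interpret pasl_pair A ord B
    using assms by unfold_locales (simp_all add: lt_algebra_def)
  show ?thesis
    unfolding leading_iff_domain[OF assms(3)] leading_iff_iso_gen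
    by (simp add: pasl_leading.S_terminates pasl_leading.S_output_groebner_basis)
qed

end
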